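(* The vertex slice sequences of the hypercubes of dimension $2$ to $7$ are: \begin{align*} VSS(Q_2)&=[2],\\ VSS(Q_3)&=[6],\\ VSS(Q_4)&=[12]\setminus\{3,5\},\\ VSS(Q_5)&=[30]\setminus\{3,6,7,9\},\\ VSS(Q_6)&=[60]\setminus\{3,5,7,9,11,12,59\},\\ VSS(Q_7)&=[140]\setminus\{3,5,6,9,10,11,13,14,15,18\}. \end{align*}
   Context: For a positive integer $n$, $[n]=\{1,2,\dots,n\}$. $Q_d$ is the convex hull of the $2^d$ points of $\mathbb{R}^d$ all of whose coordinates are $0$ or $1$. For a $d$-dimensional convex polytope $P\subset\mathbb{R}^d$, let $\mathcal{H}_P$ be the set of affine hyperplanes $H$ with $H\cap P\neq\emptyset$, and let $cv_P(H)=|V(H\cap P)|$ be the number of vertices of the slice $H\cap P$. The vertex slice sequence is the set of values $VSS(P)=cv_P(\mathcal{H}_P)$. *)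

theory Defs
  imports "HOL-Analysis.Analysis"
begin

definition hypercube :: "(real ^ 'n) set" where
  "hypercube = convex hull {x. \<forall>i. x $ i = 0 \<or> x $ i = 1}"

definition affine_hyperplane :: "'a::euclidean_space set \<Rightarrow> bool" where
  "affine_hyperplane H \<longleftrightarrow> (\<exists>a b. a \<noteq> 0 \<and> H = {x. a \<bullet> x = b})"

definition vertices :: "'a::euclidean_space set \<Rightarrow> 'a set" where
  "vertices P = {v. v extreme_point_of P}"

definition meeting_hyperplanes :: "'a::euclidean_space set \<Rightarrow> 'a set set" where
  "meeting_hyperplanes P = {H. affine_hyperplane H \<and> H \<inter> P \<noteq> {}}"

definition slice_vertex_count :: "'a::euclidean_space set \<Rightarrow> 'a set \<Rightarrow> nat" where
  "slice_vertex_count P H = card (vertices (H \<inter> P))"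

definition VSS :: "'a::euclidean_space set \<Rightarrow> nat set" where
  "VSS P = slice_vertex_count P ` meeting_hyperplanes P"

text \<open>
  The cardinality above is never the default value of an infinite set: a hyperplane
  slice of a polytope is a polytope, so it has finitely many vertices, and at least one
  when it is nonempty.
\<close>

lemma
  assumes "polytope P" and "H \<in> meeting_hyperplanes P"
  shows finite_slice_vertices: "finite (vertices (H \<inter> P))"
    and slice_vertex_count_pos: "slice_vertex_count P H > 0"
proof -
  obtain a b where H: "H = {x. a \<bullet> x = b}"
    using assms(2) by (auto simp: meeting_hyperplanes_def affine_hyperplane_def)
  have ne: "H \<inter> P \<noteq> {}"
    using assms(2) by (simp add: meeting_hyperplanes_def)
  have "polyhedron (H \<inter> P)"
    unfolding H by (intro polyhedron_Int polyhedron_hyperplane polytope_imp_polyhedron assms(1))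
  moreover have "bounded (H \<inter> P)"
    using polytope_imp_bounded[OF assms(1)] by (rule bounded_subset) simp
  ultimately have p: "polytope (H \<inter> P)"
    by (simp add: polytope_eq_bounded_polyhedron)
  show fin: "finite (vertices (H \<inter> P))"
    unfolding vertices_def
    using finite_polyhedron_extreme_points[OF \<open>polyhedron (H \<inter> P)\<close>] by simp
  have "vertices (H \<inter> P) \<noteq> {}"
    unfolding vertices_def
    using extreme_point_exists_convex[of "H \<inter> P"] polytope_imp_compact[OF p]
      polytope_imp_convex[OF p] ne by blast
  with fin show "slice_vertex_count P H > 0"
    by (simp add: slice_vertex_count_def card_gt_0_iff)
qed

end

theory Submission
  imports Defs
begin

text \<open>
  Identify the vertices of the \<open>n\<close>-cube with the subsets of an \<open>n\<close>-set \<open>S\<close>. A slice by a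
  hyperplane has one vertex for each cube vertex on the hyperplane and one for each cube edge that
  the hyperplane crosses strictly (\<open>vertices_slice\<close>). After reflecting coordinates, the hyperplane is
  \<open>a \<bullet> x = t\<close> with nonnegative \<open>a\<close>, so the count depends only on the weights \<open>sum a A\<close>.
  A zero coefficient doubles the count of a lower-dimensional slice, and a hyperplane that touches
  the cube in one vertex has count 1; the essential case is that of positive \<open>a\<close> and
  \<open>0 < t < sum a S\<close>.

  In this case each maximal chain of subsets from \<open>{}\<close> to \<open>S\<close> meets the hyperplane exactly
  once. Weighting vertices and edges by the number of chains through them gives a total of exactly
  \<open>n!\<close> (\<open>chain_identity\<close>), in the manner of the LYM inequality. The least weight is that of the
  edges between the middle layers, which gives the maxima 2, 6, 12, 30, 60, 140
  (\<open>slice_count_le_max\<close>). Since the total is exact, 59 is impossible in dimension 6 by looking at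
  how the weights could add up (\<open>slice_count_6_ne_59\<close>).

  For the gaps among small values, call a coordinate \<open>j\<close> heavy if \<open>a j \<ge> t\<close>, and light otherwise.
  If \<open>b\<close> is the number of sets of light coordinates below the hyperplane, and \<open>c\<close> is the slice
  count of the light coordinates, then \<open>m\<close> heavy coordinates raise the count to \<open>c + m b\<close>
  (\<open>slice_count_heavy\<close>). Few light coordinates leave few possibilities, such as \<open>n\<close> for cutting
  off a vertex and \<open>2 (n - 1)\<close> for cutting off an edge, while many light coordinates force a
  large \<open>b\<close> or, by the chain identity, a large \<open>c\<close> (\<open>light_profile\<close>). If there is no heavy
  coordinate, even after exchanging the two sides of the hyperplane, the chain identity alone
  gives at least \<open>n (n - 1) / 2\<close> vertices (\<open>balanced_slice_count_ge\<close>). All gaps follow by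
  comparing these bounds in \<open>proper_slice_count_not_low_gap\<close>.

  The values that remain are realized by explicit integer weights and levels, whose slice counts are
  evaluated by the recursion that adds one coordinate (\<open>slice_count_insert\<close>).
\<close>

section \<open>Counting the vertices of a slice by subsets\<close>

text \<open>
  A subset \<open>A\<close> of the finite coordinate set \<open>S\<close> stands for the cube vertex with indicator
  \<open>A\<close>, at which the linear form with coefficients \<open>a\<close> takes the value \<open>sum a A\<close>. The vertices
  of the slice at level \<open>t\<close> are the cube vertices on the hyperplane and one point on each
  edge \<open>A\<close> -- \<open>insert i A\<close> whose endpoints lie strictly on different sides of it. Keeping \<open>S\<close>
  an explicit set, not a type, is what makes it possible to add and remove coordinates.
\<close>

definition zeros :: "'a set \<Rightarrow> ('a \<Rightarrow> real) \<Rightarrow> real \<Rightarrow> 'a set set" where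
  "zeros S a t = {A. A \<subseteq> S \<and> sum a A = t}"

definition crossings :: "'a set \<Rightarrow> ('a \<Rightarrow> real) \<Rightarrow> real \<Rightarrow> ('a set \<times> 'a) set" where
  "crossings S a t = {(A, i). A \<subseteq> S \<and> i \<in> S - A \<and> sum a A < t \<and> t < sum a A + a i}"

definition slice_count :: "'a set \<Rightarrow> ('a \<Rightarrow> real) \<Rightarrow> real \<Rightarrow> nat" where
  "slice_count S a t = card (zeros S a t) + card (crossings S a t)"

definition band :: "'a set \<Rightarrow> ('a \<Rightarrow> real) \<Rightarrow> real \<Rightarrow> real \<Rightarrow> 'a set set" where
  "band S a l u = {A. A \<subseteq> S \<and> l < sum a A \<and> sum a A < u}"

definition below :: "'a set \<Rightarrow> ('a \<Rightarrow> real) \<Rightarrow> real \<Rightarrow> 'a set set" where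
  "below S a t = {A. A \<subseteq> S \<and> sum a A < t}"

lemma finite_slice_sets:
  assumes "finite S"
  shows "finite (zeros S a t)" "finite (crossings S a t)" "finite (band S a l u)" "finite (below S a t)"
proof -
  have "crossings S a t \<subseteq> Pow S \<times> S" by (auto simp: crossings_def)
  then show "finite (crossings S a t)" using assms finite_subset by blast
qed (use assms in \<open>auto simp: zeros_def band_def below_def intro: finite_subset[of _ "Pow S"]\<close>)

lemma subset_insert_cases:
  assumes "finite S" "j \<notin> S" "A \<subseteq> insert j S"
  obtains "A \<subseteq> S" | B where "B \<subseteq> S" "A = insert j B" "sum a A = a j + sum (a :: 'a \<Rightarrow> real) B"
proof (cases "j \<in> A")
  case False
  then show ?thesis using assms that(1) by blast
next
  case True
  let ?B = "A - {j}"
  have "?B \<subseteq> S" "A = insert j ?B" "finite ?B" using True assms by (auto intro: finite_subset)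
  moreover from this have "sum a A = a j + sum a ?B" by (metis DiffD2 insertI1 sum.insert)
  ultimately show ?thesis using that(2) by blast
qed

lemma sum_insert_subset:
  assumes "finite S" "j \<notin> S" "B \<subseteq> S"
  shows "sum a (insert j B) = a j + sum (a :: 'a \<Rightarrow> real) B"
  using assms by (meson finite_subset subsetD sum.insert)

lemma inj_on_insert_Pow:
  assumes "j \<notin> S" "M \<subseteq> Pow S" shows "inj_on (insert j) M"
  using assms by (intro inj_onI) (metis PowD insert_ident subsetD)

lemma band_insert:
  assumes fin: "finite S" and j: "j \<notin> S"
  shows "card (band (insert j S) a l u) = card (band S a l u) + card (band S a (l - a j) (u - a j))"
proof -
  have eq: "band (insert j S) a l u = band S a l u \<union> insert j ` band S a (l - a j) (u - a j)"
  proof (intro equalityI subsetI)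
    fix A assume A: "A \<in> band (insert j S) a l u"
    then have "A \<subseteq> insert j S" by (simp add: band_def)
    with fin j show "A \<in> band S a l u \<union> insert j ` band S a (l - a j) (u - a j)"
      using A by (cases rule: subset_insert_cases[where a = a]) (auto simp: band_def)
  qed (auto simp: band_def sum_insert_subset[OF fin j])
  have "card (insert j ` band S a (l - a j) (u - a j)) = card (band S a (l - a j) (u - a j))"
    by (rule card_image, rule inj_on_insert_Pow[OF j]) (auto simp: band_def)
  moreover have "band S a l u \<inter> insert j ` band S a (l - a j) (u - a j) = {}"
    using j by (auto simp: band_def)
  ultimately show ?thesis
    unfolding eq using fin by (subst card_Un_disjoint) (auto simp: finite_slice_sets)
qed

text \<open>
  The new coordinate splits the cube into two parallel facets joined by edges. The facets
  contribute slices at the levels \<open>t\<close> and \<open>t - a j\<close>; the joining edge above \<open>A\<close> is crossed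
  exactly if \<open>sum a A\<close> lies in the open band between these levels. This one recursion yields the
  doubling rule for zero coefficients, the rule for heavy coordinates, and the evaluation of
  concrete slices.
\<close>

lemma slice_count_insert:
  assumes fin: "finite S" and j: "j \<notin> S"
  shows "slice_count (insert j S) a t =
    slice_count S a t + slice_count S a (t - a j) + card (band S a (t - a j) t)"
proof -
  let ?s = "t - a j"
  have z: "zeros (insert j S) a t = zeros S a t \<union> insert j ` zeros S a ?s"
  proof (intro equalityI subsetI)
    fix A assume A: "A \<in> zeros (insert j S) a t"
    then have "A \<subseteq> insert j S" by (simp add: zeros_def)
    with fin j show "A \<in> zeros S a t \<union> insert j ` zeros S a ?s"
      using A by (cases rule: subset_insert_cases[where a = a]) (auto simp: zeros_def)
  qed (auto simp: zeros_def sum_insert_subset[OF fin j])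
  have "card (insert j ` zeros S a ?s) = card (zeros S a ?s)"
    by (rule card_image, rule inj_on_insert_Pow[OF j]) (auto simp: zeros_def)
  moreover have "zeros S a t \<inter> insert j ` zeros S a ?s = {}"
    using j by (auto simp: zeros_def)
  ultimately have cz: "card (zeros (insert j S) a t) = card (zeros S a t) + card (zeros S a ?s)"
    unfolding z using fin by (subst card_Un_disjoint) (auto simp: finite_slice_sets)
  let ?up = "\<lambda>(A, i). (insert j A, i)" and ?ed = "\<lambda>A. (A, j)"
  have c: "crossings (insert j S) a t =
      crossings S a t \<union> (?up ` crossings S a ?s \<union> ?ed ` band S a ?s t)"
  proof (intro equalityI subsetI)
    fix x assume x: "x \<in> crossings (insert j S) a t"
    obtain A i where Ai: "x = (A, i)" by fastforce
    with x have h: "A \<subseteq> insert j S" "i \<in> insert j S - A" "sum a A < t" "t < sum a A + a i"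
      by (auto simp: crossings_def)
    from fin j h(1) show "x \<in> crossings S a t \<union> (?up ` crossings S a ?s \<union> ?ed ` band S a ?s t)"
    proof (cases rule: subset_insert_cases[where a = a])
      case 1
      then show ?thesis using h Ai by (cases "i = j") (auto simp: crossings_def band_def)
    next
      case (2 B)
      then have "(B, i) \<in> crossings S a ?s" using h by (auto simp: crossings_def)
      then show ?thesis using 2 Ai by force
    qed
  next
    fix x assume "x \<in> crossings S a t \<union> (?up ` crossings S a ?s \<union> ?ed ` band S a ?s t)"
    then show "x \<in> crossings (insert j S) a t"
      using j by (auto simp: crossings_def band_def sum_insert_subset[OF fin j])
  qed
  have "inj_on ?up (crossings S a ?s)"
  proof (rule inj_onI, clarsimp)
    fix A i B assume "(A, i) \<in> crossings S a ?s" "(B, i) \<in> crossings S a ?s" "insert j A = insert j B"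
    then show "A = B" using j by (metis (no_types, lifting) case_prodD crossings_def insert_ident mem_Collect_eq subsetD)
  qed
  then have "card (?up ` crossings S a ?s) = card (crossings S a ?s)" by (rule card_image)
  moreover have "card (?ed ` band S a ?s t) = card (band S a ?s t)"
    by (rule card_image) (auto intro: inj_onI)
  moreover have "?up ` crossings S a ?s \<inter> ?ed ` band S a ?s t = {}"
    using j by (auto simp: band_def crossings_def)
  moreover have "crossings S a t \<inter> (?up ` crossings S a ?s \<union> ?ed ` band S a ?s t) = {}"
    using j by (auto simp: band_def crossings_def)
  ultimately have cc: "card (crossings (insert j S) a t) =
      card (crossings S a t) + (card (crossings S a ?s) + card (band S a ?s t))"
    unfolding c using fin by (simp add: card_Un_disjoint finite_slice_sets)
  show ?thesis unfolding slice_count_def cz cc by simp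
qed

lemma slice_count_empty: "slice_count {} a t = (if t = 0 then 1 else 0)"
proof -
  have "zeros {} a t = (if t = 0 then {{}} else {})" "crossings {} a t = {}"
    by (auto simp: zeros_def crossings_def)
  then show ?thesis by (simp add: slice_count_def)
qed

lemma band_empty: "card (band {} a l u) = (if l < 0 \<and> 0 < u then 1 else 0)"
proof -
  have "band {} a l u = (if l < 0 \<and> 0 < u then {{}} else {})"
    by (auto simp: band_def)
  then show ?thesis by simp
qed

text \<open>
  The point reflection of the cube, \<open>A \<mapsto> S - A\<close>, exchanges the two sides of the hyperplane.
\<close>

lemma slice_count_dual:
  assumes fin: "finite S"
  shows "slice_count S a (sum a S - t) = slice_count S a t"
proof -
  have d: "sum a (S - A) = sum a S - sum a A" if "A \<subseteq> S" for A
    using that fin by (simp add: sum_diff)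
  have i: "sum a (insert i A) = a i + sum a A" if "A \<subseteq> S" "i \<in> S - A" for A i
    using that fin by (meson DiffD2 finite_subset sum.insert)
  have "bij_betw (\<lambda>A. S - A) (zeros S a (sum a S - t)) (zeros S a t)"
    by (rule bij_betw_byWitness[where f' = "\<lambda>A. S - A"]) (auto simp: zeros_def d)
  moreover have "bij_betw (\<lambda>(A, i). (S - insert i A, i)) (crossings S a (sum a S - t)) (crossings S a t)"
    by (rule bij_betw_byWitness[where f' = "\<lambda>(A, i). (S - insert i A, i)"])
       (auto simp: crossings_def d i)
  ultimately show ?thesis by (simp add: slice_count_def bij_betw_same_card)
qed

lemma slice_count_insert_zero:
  assumes "finite S" "j \<notin> S" "a j = 0"
  shows "slice_count (insert j S) a t = 2 * slice_count S a t"
proof -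
  have "band S a t t = {}" by (auto simp: band_def)
  then show ?thesis using slice_count_insert[OF assms(1,2), of a t] assms(3) by simp
qed

lemma sum_subset_less:
  assumes "finite S" "\<forall>i\<in>S. 0 < a i" "A \<subseteq> S" "B \<subset> A"
  shows "sum a B < sum (a :: 'a \<Rightarrow> real) A"
proof -
  have "finite A" "\<And>i. i \<in> A \<Longrightarrow> 0 < a i" using assms finite_subset by blast+
  moreover obtain b where "b \<in> A - B" using assms(4) by auto
  ultimately show ?thesis using assms(4) by (intro sum_strict_mono2[of A B b]) (auto intro: less_imp_le)
qed

lemma sum_subset_pos:
  assumes "finite S" "\<forall>i\<in>S. 0 < a i" "A \<subseteq> S" "A \<noteq> {}"
  shows "0 < sum (a :: 'a \<Rightarrow> real) A"
  using sum_subset_less[OF assms(1,2,3), where B = "{}"] assms(4) by auto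

lemma slice_count_zero:
  assumes "finite S" "\<forall>i\<in>S. 0 < a i"
  shows "slice_count S a 0 = 1"
proof -
  have p: "0 < sum a A" if "A \<subseteq> S" "A \<noteq> {}" for A using sum_subset_pos[OF assms that] .
  have "zeros S a 0 = {{}}" 
  proof (intro equalityI subsetI)
    fix A assume "A \<in> zeros S a 0"
    then show "A \<in> {{}}" using p[of A] by (auto simp: zeros_def)
  qed (auto simp: zeros_def)
  moreover have "crossings S a 0 = {}"
  proof -
    have False if "A \<subseteq> S" "sum a A < 0" for A
      using p[OF that(1)] that by (cases "A = {}") auto
    then show ?thesis by (auto simp: crossings_def)
  qed
  ultimately show ?thesis by (simp add: slice_count_def)
qed

lemma slice_count_neg:
  assumes "finite S" "\<forall>i\<in>S. 0 < a i" "t < 0"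
  shows "slice_count S a t = 0"
proof -
  have p: "0 \<le> sum a A" if "A \<subseteq> S" for A 
    using that assms(2) by (intro sum_nonneg) (auto intro: less_imp_le)
  have "\<not> (sum a A \<le> t)" if "A \<subseteq> S" for A using p[OF that] assms(3) by simp
  then have "zeros S a t = {}" "crossings S a t = {}"
    by (auto simp: zeros_def crossings_def dest: less_imp_le)
  then show ?thesis by (simp add: slice_count_def)
qed

section \<open>Heavy coordinates\<close>

text \<open>
  If \<open>a j \<ge> t\<close>, the facet through the far end of coordinate \<open>j\<close> lies weakly beyond the
  hyperplane, so what coordinate \<open>j\<close> adds is one crossing (or one vertex, if \<open>a j = t\<close> and
  \<open>A = {}\<close>) for each \<open>A\<close> strictly below the hyperplane.
\<close>

lemma slice_count_insert_heavy:
  assumes fin: "finite S" and pos: "\<forall>i\<in>S. 0 < a i" and j: "j \<notin> S"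
    and t: "0 < t" "t \<le> a j"
  shows "slice_count (insert j S) a t = slice_count S a t + card (below S a t)"
proof (cases "t = a j")
  case True
  have "below S a t = insert {} (band S a 0 t)"
  proof (intro equalityI subsetI)
    fix A assume "A \<in> below S a t"
    then show "A \<in> insert {} (band S a 0 t)"
      using sum_subset_pos[OF fin pos, where A = A] by (auto simp: below_def band_def)
  qed (use t in \<open>auto simp: below_def band_def\<close>)
  moreover have "{} \<notin> band S a 0 t" by (simp add: band_def)
  ultimately have "card (below S a t) = 1 + card (band S a 0 t)"
    using fin by (simp add: finite_slice_sets)
  then show ?thesis
    using slice_count_insert[OF fin j, of a t] True slice_count_zero[OF fin pos] by simp
next
  case False
  have "0 \<le> sum a A" if "A \<subseteq> S" for A
    using that pos by (intro sum_nonneg) (auto intro: less_imp_le)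
  then have "band S a (t - a j) t = below S a t"
    using False t by (auto simp: band_def below_def intro: less_le_trans[of "t - a j" 0])
  then show ?thesis
    using slice_count_insert[OF fin j, of a t] slice_count_neg[OF fin pos, of "t - a j"] False t
    by simp
qed

lemma below_insert_heavy:
  assumes fin: "finite S" and pos: "\<forall>i\<in>S. 0 < a i" and j: "j \<notin> S" and t: "t \<le> a j"
  shows "below (insert j S) a t = below S a t"
proof (intro equalityI subsetI)
  fix A assume A: "A \<in> below (insert j S) a t"
  then have "A \<subseteq> insert j S" by (simp add: below_def)
  with fin j show "A \<in> below S a t"
  proof (cases rule: subset_insert_cases[where a = a])
    case 1 then show ?thesis using A by (simp add: below_def)
  next
    case (2 B)
    have "0 \<le> sum a B" using 2(1) pos by (intro sum_nonneg) (auto intro: less_imp_le)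
    then show ?thesis using 2 A t by (simp add: below_def)
  qed
qed (auto simp: below_def)

text \<open>
  Adding a heavy coordinate does not change the family of sets below the hyperplane, hence a set
  \<open>T\<close> of heavy coordinates adds the same number \<open>card T\<close> times.
\<close>

lemma slice_count_heavy:
  assumes fin: "finite S" and "finite T" and "S \<inter> T = {}"
    and pos: "\<forall>i\<in>S \<union> T. 0 < a i"
    and t: "0 < t" "\<And>j. j \<in> T \<Longrightarrow> t \<le> a j"
  shows "slice_count (S \<union> T) a t = slice_count S a t + card T * card (below S a t) \<and>
         below (S \<union> T) a t = below S a t"
  using assms(2,3,4,6)
proof (induction T)
  case empty then show ?case by simp
next
  case (insert j T)
  have IH: "slice_count (S \<union> T) a t = slice_count S a t + card T * card (below S a t)"
    "below (S \<union> T) a t = below S a t" using insert by auto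
  have h: "finite (S \<union> T)" "j \<notin> S \<union> T" "t \<le> a j" and "\<forall>i\<in>S \<union> T. 0 < a i"
    using insert fin by auto
  then show ?case
    using slice_count_insert_heavy[of "S \<union> T" a j t] below_insert_heavy[of "S \<union> T" a j t] t(1) IH
      insert(1,2) by simp
qed

section \<open>An LYM identity for slices\<close>

text \<open>
  The weights \<open>k! (n - k)!\<close> and \<open>k! (n - 1 - k)!\<close> count the maximal chains from \<open>{}\<close> to
  \<open>S\<close> that pass through a given set of size \<open>k\<close>, respectively through a given edge whose lower
  end has size \<open>k\<close>.
\<close>

abbreviation vertex_weight :: "nat \<Rightarrow> nat \<Rightarrow> nat" where
  "vertex_weight n k \<equiv> fact k * fact (n - k)"

abbreviation edge_weight :: "nat \<Rightarrow> nat \<Rightarrow> nat" where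
  "edge_weight n k \<equiv> fact k * fact (n - 1 - k)"

lemma edge_weights_at_lower_end:
  assumes "k < n"
  shows "(n - k) * edge_weight n k = vertex_weight n k"
proof -
  have "n - k = Suc (n - 1 - k)" using assms by simp
  then show ?thesis by (simp add: algebra_simps)
qed

lemma edge_weights_at_upper_end:
  assumes "0 < k" "k \<le> n"
  shows "k * edge_weight n (k - 1) = vertex_weight n k"
proof -
  obtain m where "k = Suc m" using assms(1) gr0_conv_Suc by auto
  then show ?thesis by (simp add: algebra_simps)
qed

text \<open>
  The inflow half of the flow argument for a family \<open>M\<close> all of whose lower neighbours lie in
  \<open>N\<close>: each \<open>B \<in> M\<close> is entered by \<open>card B\<close> edges.
\<close>

lemma inflow_sum:
  assumes fin: "finite S" and M: "M \<subseteq> Pow S" "{} \<notin> M"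
    and N: "N \<subseteq> Pow S" "\<And>B i. B \<in> M \<Longrightarrow> i \<in> B \<Longrightarrow> B - {i} \<in> N"
  shows "(\<Sum>(A, i) \<in> {(A, i). A \<in> N \<and> i \<in> S - A \<and> insert i A \<in> M}. edge_weight (card S) (card A)) =
         (\<Sum>B\<in>M. vertex_weight (card S) (card B))"
proof -
  let ?w = "edge_weight (card S)"
  have fM: "finite M" and fB: "\<And>B. B \<in> M \<Longrightarrow> finite B"
    using M(1) fin by (auto intro: finite_subset)
  have "(\<Sum>(A, i) \<in> {(A, i). A \<in> N \<and> i \<in> S - A \<and> insert i A \<in> M}. ?w (card A)) =
        (\<Sum>(B, i) \<in> Sigma M (\<lambda>B. B). ?w (card B - 1))"
  proof (rule sum.reindex_bij_witness[where j = "\<lambda>(A, i). (insert i A, i)" and i = "\<lambda>(B, i). (B - {i}, i)"])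
    fix x assume "x \<in> {(A, i). A \<in> N \<and> i \<in> S - A \<and> insert i A \<in> M}"
    then obtain A i where x: "x = (A, i)" "A \<in> N" "i \<in> S - A" "insert i A \<in> M" by auto
    then have "finite A" using fB by fastforce
    then show "(case (case x of (A, i) \<Rightarrow> (insert i A, i)) of (B, i) \<Rightarrow> ?w (card B - 1)) =
               (case x of (A, i) \<Rightarrow> ?w (card A))"
      using x by simp
  qed (use M N in \<open>auto simp: insert_absorb\<close>)
  also have "\<dots> = (\<Sum>B\<in>M. \<Sum>i\<in>B. ?w (card B - 1))"
    using fM fB by (subst sum.Sigma) auto
  also have "\<dots> = (\<Sum>B\<in>M. vertex_weight (card S) (card B))"
  proof (rule sum.cong)
    fix B assume B: "B \<in> M"
    then have "0 < card B" "card B \<le> card S"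
      using fB M fin by (auto simp: card_gt_0_iff intro!: card_mono)
    then show "(\<Sum>i\<in>B. ?w (card B - 1)) = vertex_weight (card S) (card B)"
      using edge_weights_at_upper_end[of "card B" "card S"] by (simp del: One_nat_def)
  qed simp
  finally show ?thesis .
qed

text \<open>
  For positive coefficients every maximal chain meets the hyperplane exactly once, in a vertex or
  in the interior of an edge. Instead of counting chains, the proof reads the weights as a flow:
  at every set other than \<open>{}\<close> and \<open>S\<close>, both the edges entering it and the edges leaving it
  carry together its vertex weight. Summed over the sets below the hyperplane, the
  outflow minus the inflow is the amount \<open>n!\<close> produced at \<open>{}\<close>, and it leaves through the
  crossings and through the vertices on the hyperplane.
\<close>

lemma chain_identity:
  assumes fin: "finite S" and pos: "\<forall>i\<in>S. 0 < a i" and t: "0 < t" "t \<le> sum a S"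
  shows "(\<Sum>A\<in>zeros S a t. vertex_weight (card S) (card A)) +
         (\<Sum>(A, i)\<in>crossings S a t. edge_weight (card S) (card A)) = fact (card S)"
proof -
  let ?N = "below S a t" and ?Z = "zeros S a t" and ?C = "crossings S a t" and ?n = "card S"
  let ?e = "\<lambda>(A, i :: 'a). edge_weight ?n (card A)"
  have fN: "finite ?N" and fZ: "finite ?Z" and fC: "finite ?C" using fin finite_slice_sets by auto
  have N: "?N \<subseteq> Pow S" "{} \<in> ?N" using t by (auto simp: below_def)
  have down: "B - {i} \<in> ?N" if "B \<subseteq> S" "sum a B \<le> t" "i \<in> B" for B i
    using sum_subset_less[OF fin pos, of B "B - {i}"] that by (force simp: below_def)
  \<comment> \<open>The edges that lead from a set below the hyperplane into the family \<open>M\<close>.\<close>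
  define E where "E M = {(A, i). A \<in> ?N \<and> i \<in> S - A \<and> insert i A \<in> M}" for M
  have fE: "finite (E M)" for M
    by (rule finite_subset[of _ "?N \<times> S"]) (use fN fin in \<open>auto simp: E_def\<close>)
  have out: "(\<Sum>A\<in>?N. vertex_weight ?n (card A)) = (\<Sum>x\<in>E (Pow S). ?e x)"
  proof -
    have "E (Pow S) = Sigma ?N (\<lambda>A. S - A)" using N by (auto simp: E_def)
    then have "(\<Sum>x\<in>E (Pow S). ?e x) = (\<Sum>A\<in>?N. \<Sum>i\<in>S - A. edge_weight ?n (card A))"
      using fN fin by (simp only:) (subst sum.Sigma, auto)
    also have "\<dots> = (\<Sum>A\<in>?N. vertex_weight ?n (card A))"
    proof (rule sum.cong)
      fix A assume A: "A \<in> ?N"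
      then have "A \<subset> S" using t by (auto simp: below_def)
      then have "card A < ?n" "card (S - A) = ?n - card A" 
        using fin by (auto simp: psubset_card_mono card_Diff_subset finite_subset)
      then show "(\<Sum>i\<in>S - A. edge_weight ?n (card A)) = vertex_weight ?n (card A)"
        using edge_weights_at_lower_end[of "card A" ?n] by (simp del: One_nat_def)
    qed simp
    finally show ?thesis by simp
  qed
  have split: "E (Pow S) = E (?N - {{}}) \<union> (E ?Z \<union> ?C)"
  proof -
    have "sum a (insert i A) = a i + sum a A" if "A \<subseteq> S" "i \<in> S - A" for A i
      using that fin by (meson DiffD2 finite_subset sum.insert)
    then show ?thesis by (auto simp: E_def below_def zeros_def crossings_def algebra_simps)
  qed
  have "E ?Z \<inter> ?C = {}" "E (?N - {{}}) \<inter> (E ?Z \<union> ?C) = {}"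
  proof -
    have "sum a (insert i A) = a i + sum a A" if "A \<subseteq> S" "i \<in> S" "i \<notin> A" for A i
      using that fin by (meson finite_subset sum.insert)
    then show "E ?Z \<inter> ?C = {}" "E (?N - {{}}) \<inter> (E ?Z \<union> ?C) = {}"
      by (auto simp: E_def below_def zeros_def crossings_def)
  qed
  then have "(\<Sum>x\<in>E (Pow S). ?e x) =
      (\<Sum>x\<in>E (?N - {{}}). ?e x) + ((\<Sum>x\<in>E ?Z. ?e x) + (\<Sum>x\<in>?C. ?e x))"
    unfolding split using fE fC by (simp add: sum.union_disjoint)
  moreover have "(\<Sum>x\<in>E (?N - {{}}). ?e x) = (\<Sum>A\<in>?N - {{}}. vertex_weight ?n (card A))"
    unfolding E_def by (rule inflow_sum[OF fin]) (use N down in \<open>auto simp: below_def\<close>)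
  moreover have "(\<Sum>x\<in>E ?Z. ?e x) = (\<Sum>A\<in>?Z. vertex_weight ?n (card A))"
    unfolding E_def by (rule inflow_sum[OF fin]) (use N t down in \<open>auto simp: zeros_def\<close>)
  moreover have "(\<Sum>A\<in>?N. vertex_weight ?n (card A)) = 
      fact ?n + (\<Sum>A\<in>?N - {{}}. vertex_weight ?n (card A))"
    using sum.remove[OF fN N(2), of "\<lambda>A. vertex_weight ?n (card A)"] by simp
  ultimately show ?thesis using out by linarith
qed

text \<open>
  Vertex weights dominate edge weights, so a lower bound on edge weights suffices.
\<close>

lemma slice_count_le_of_weights:
  assumes fin: "finite S" and pos: "\<forall>i\<in>S. 0 < a i" and t: "0 < t" "t \<le> sum a S"
    and c: "\<And>k. k < card S \<Longrightarrow> c \<le> edge_weight (card S) k"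
  shows "c * slice_count S a t \<le> fact (card S)"
proof -
  let ?n = "card S"
  have n: "0 < ?n" using t fin by (auto simp: card_gt_0_iff)
  have cv: "c \<le> vertex_weight ?n k" if "k \<le> ?n" for k
  proof (cases "k < ?n")
    case True
    have "c \<le> edge_weight ?n k" using True by (rule c)
    also have "\<dots> \<le> (?n - k) * edge_weight ?n k" using True by simp
    finally show ?thesis unfolding edge_weights_at_lower_end[OF True] .
  next
    case False
    then have "k = ?n" using that by simp
    moreover have "c \<le> fact (?n - 1)" using c[of "?n - 1"] n by simp
    moreover have "(fact (?n - 1) :: nat) \<le> fact ?n" by (rule fact_mono_nat) simp
    ultimately show ?thesis by simp
  qed
  have "c * card (zeros S a t) \<le> (\<Sum>A\<in>zeros S a t. vertex_weight ?n (card A))"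
    using sum_bounded_below[of "zeros S a t" c "\<lambda>A. vertex_weight ?n (card A)"] cv fin
    by (simp add: zeros_def card_mono mult.commute)
  moreover have "c * card (crossings S a t) \<le> (\<Sum>(A, i)\<in>crossings S a t. edge_weight ?n (card A))"
  proof -
    have "c \<le> (case x of (A, i) \<Rightarrow> edge_weight ?n (card A))" if "x \<in> crossings S a t" for x
    proof -
      obtain A i where x: "x = (A, i)" by fastforce
      with that have "A \<subset> S" by (auto simp: crossings_def)
      then have "card A < ?n" using fin by (simp add: psubset_card_mono)
      then show ?thesis using c x by simp
    qed
    then show ?thesis
      using sum_bounded_below[of "crossings S a t" c "\<lambda>(A, i). edge_weight ?n (card A)"] 
      by (simp add: mult.commute)
  qed
  ultimately show ?thesis
    using chain_identity[OF fin pos t] by (simp add: slice_count_def distrib_left)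
qed

lemma slice_count_ge_of_weights:
  assumes fin: "finite S" and pos: "\<forall>i\<in>S. 0 < a i" and t: "0 < t" "t \<le> sum a S"
    and z: "\<And>A. A \<in> zeros S a t \<Longrightarrow> vertex_weight (card S) (card A) \<le> c"
    and e: "\<And>A i. (A, i) \<in> crossings S a t \<Longrightarrow> edge_weight (card S) (card A) \<le> c"
  shows "fact (card S) \<le> c * slice_count S a t"
proof -
  let ?n = "card S"
  have "(\<Sum>A\<in>zeros S a t. vertex_weight ?n (card A)) \<le> c * card (zeros S a t)"
    using sum_bounded_above[of "zeros S a t" "\<lambda>A. vertex_weight ?n (card A)" c] z
    by (simp add: mult.commute)
  moreover have "(\<Sum>(A, i)\<in>crossings S a t. edge_weight ?n (card A)) \<le> c * card (crossings S a t)"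
    using sum_bounded_above[of "crossings S a t" "\<lambda>(A, i). edge_weight ?n (card A)" c] e
    by (fastforce simp: mult.commute)
  ultimately show ?thesis
    using chain_identity[OF fin pos t] by (simp add: slice_count_def distrib_left)
qed

text \<open>
  Log-convexity of the factorial: moving the two arguments apart with a fixed sum increases the
  product.
\<close>

lemma fact_prod_spread:
  assumes "r \<le> k" "r \<le> l"
  shows "fact k * fact l \<le> (fact r * fact (k + l - r) :: nat)"
  using assms(1)
proof (induction k rule: dec_induct)
  case base then show ?case by simp
next
  case (step m)
  have "fact (Suc m) * fact l = Suc m * (fact m * fact l)" by (simp add: algebra_simps)
  also have "\<dots> \<le> Suc (m + l - r) * (fact r * fact (m + l - r))"
  proof (rule mult_le_mono)
    show "Suc m \<le> Suc (m + l - r)" using assms(2) by simp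
  qed (rule step.IH)
  also have "\<dots> = fact r * fact (Suc m + l - r)"
    using step assms(2) by (simp add: Suc_diff_le algebra_simps)
  finally show ?case .
qed

lemma subset_card_le_1_cases:
  assumes "finite S" "A \<subseteq> S" "card A \<le> 1"
  obtains "A = {}" | j where "j \<in> S" "A = {j}"
proof (cases "A = {}")
  case False
  then have "card A = 1" using assms card_gt_0_iff[of A] finite_subset[of A S] by auto
  then obtain j where "A = {j}" by (rule card_1_singletonE)
  then show ?thesis using that(2) assms(2) by simp
qed (use that in simp)

section \<open>Bounds from the identity\<close>

text \<open>
  If all coordinates are light, that is \<open>a j < t\<close>, then every set reaching the level has at least
  two elements. This excludes the heaviest chain weights, those at the bottom of the cube.
\<close>

lemma light_card_ge_2:
  fixes a :: "'a \<Rightarrow> real"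
  assumes fin: "finite S" and t: "0 < t" and light: "\<forall>j\<in>S. a j < t" 
    and A: "A \<subseteq> S" "t \<le> sum a A"
  shows "2 \<le> card A"
proof (rule ccontr)
  assume "\<not> 2 \<le> card A"
  then have "card A \<le> 1" by simp
  with fin A(1) show False
    using A(2) t light by (cases rule: subset_card_le_1_cases) auto
qed

text \<open>
  Here every weight in the chain identity is at most \<open>(n - 1)!\<close>.
\<close>

lemma light_slice_count_ge:
  assumes fin: "finite S" and pos: "\<forall>i\<in>S. 0 < a i" and t: "0 < t" "t < sum a S"
    and light: "\<forall>j\<in>S. a j < t"
  shows "card S \<le> slice_count S a t"
proof -
  let ?n = "card S"
  have n: "2 \<le> ?n" using light_card_ge_2[OF fin t(1) light, of S] t by simp
  have "fact ?n \<le> fact (?n - 1) * slice_count S a t"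
  proof (rule slice_count_ge_of_weights[OF fin pos t(1)])
    fix A assume "A \<in> zeros S a t"
    then have A: "A \<subset> S" "sum a A = t" using t by (auto simp: zeros_def)
    then have "2 \<le> card A" "card A < ?n"
      using light_card_ge_2[OF fin t(1) light, of A] fin by (auto intro: psubset_card_mono)
    then show "vertex_weight ?n (card A) \<le> fact (?n - 1)"
      using fact_prod_spread[of 1 "card A" "?n - card A"] by simp
  next
    fix A i assume "(A, i) \<in> crossings S a t"
    then have "A \<subset> S" by (auto simp: crossings_def)
    then have "card A < ?n" using fin by (auto intro: psubset_card_mono)
    then show "edge_weight ?n (card A) \<le> fact (?n - 1)"
      using fact_prod_spread[of 0 "card A" "?n - 1 - card A"] by simp
  qed (use t in simp)
  also have "(fact ?n :: nat) = ?n * fact (?n - 1)" using n by (subst fact_reduce) auto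
  finally show ?thesis by (simp add: mult.commute)
qed

text \<open>
  If the coordinates are light for \<open>t\<close> and also for the dual level \<open>sum a S - t\<close>, the heavy
  weights at the bottom and at the top of the cube are both excluded, and what remains is at
  most \<open>2 (n - 2)!\<close>.
\<close>

lemma balanced_slice_count_ge:
  assumes fin: "finite S" and pos: "\<forall>i\<in>S. 0 < a i" and t: "0 < t" "t < sum a S"
    and light: "\<forall>j\<in>S. a j < t" "\<forall>j\<in>S. a j < sum a S - t"
  shows "card S * (card S - 1) \<le> 2 * slice_count S a t"
proof -
  let ?n = "card S"
  have up: "card A + 2 \<le> ?n" if "A \<subseteq> S" "sum a A \<le> t" for A
  proof -
    have "sum a (S - A) = sum a S - sum a A" using that fin by (simp add: sum_diff)
    then have "2 \<le> card (S - A)"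
      using light_card_ge_2[OF fin _ light(2), of "S - A"] t that by auto
    moreover have "card (S - A) = ?n - card A" using that fin by (simp add: card_Diff_subset finite_subset)
    ultimately show ?thesis by simp
  qed
  have n: "2 \<le> ?n" using up[of "{}"] t by simp
  have "fact ?n \<le> (2 * fact (?n - 2)) * slice_count S a t"
  proof (rule slice_count_ge_of_weights[OF fin pos t(1)])
    fix A assume "A \<in> zeros S a t"
    then have A: "A \<subseteq> S" "sum a A = t" by (auto simp: zeros_def)
    then have "2 \<le> card A" "card A + 2 \<le> ?n"
      using light_card_ge_2[OF fin t(1) light(1), of A] up[of A] by auto
    then show "vertex_weight ?n (card A) \<le> 2 * fact (?n - 2)"
      using fact_prod_spread[of 2 "card A" "?n - card A"] by simp
  next
    fix A i assume "(A, i) \<in> crossings S a t"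
    then have A: "A \<subseteq> S" "i \<in> S" "i \<notin> A" "sum a A < t" "t < sum a (insert i A)"
      using fin by (auto simp: crossings_def finite_subset)
    have "2 \<le> card (insert i A)"
      using light_card_ge_2[OF fin t(1) light(1), of "insert i A"] A by auto
    then have "1 \<le> card A" "card A + 2 \<le> ?n"
      using up[of A] A fin by (auto simp: finite_subset)
    then have "edge_weight ?n (card A) \<le> fact (?n - 2)"
      using fact_prod_spread[of 1 "card A" "?n - 1 - card A"] by (simp add: numeral_2_eq_2)
    then show "edge_weight ?n (card A) \<le> 2 * fact (?n - 2)" by linarith
  qed (use t in simp)
  also have "(fact ?n :: nat) = ?n * (?n - 1) * fact (?n - 2)" 
    using n by (simp add: fact_reduce numeral_2_eq_2)
  finally show ?thesis by (simp add: mult.commute mult.left_commute)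
qed

section \<open>The largest slices\<close>

text \<open>
  The maximum is attained by the slice between the two middle layers of the cube: with
  \<open>h = \<lceil>n/2\<rceil>\<close>, it is the number of edges whose upper end is a set of size \<open>h\<close>.
\<close>

definition max_slice :: "nat \<Rightarrow> nat" where
  "max_slice n = (Suc n div 2) * (n choose (Suc n div 2))"

text \<open>
  The edges between the middle layers have the least chain weight, so no slice has more vertices
  than \<open>n!\<close> divided by that weight.
\<close>

lemma slice_count_le_max:
  assumes fin: "finite S" and pos: "\<forall>i\<in>S. 0 < a i" and t: "0 < t" "t < sum a S"
  shows "slice_count S a t \<le> max_slice (card S)"
proof -
  let ?n = "card S"
  have n: "0 < ?n" using t fin by (auto simp: card_gt_0_iff)
  define m where "m = (?n - 1) div 2"
  have h: "Suc ?n div 2 = Suc m" "m \<le> ?n - 1 - m" "Suc m \<le> ?n" using n by (auto simp: m_def)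
  have "edge_weight ?n m * slice_count S a t \<le> fact ?n"
  proof (rule slice_count_le_of_weights[OF fin pos t(1)])
    fix k assume k: "k < ?n"
    show "edge_weight ?n m \<le> edge_weight ?n k"
    proof (cases "k \<le> m")
      case True
      then show ?thesis using fact_prod_spread[of k m "?n - 1 - m"] h k by simp
    next
      case False
      then have "?n - 1 - k \<le> m" using False unfolding m_def by linarith
      then show ?thesis using fact_prod_spread[of "?n - 1 - k" m "?n - 1 - m"] h k 
        by (simp add: mult.commute)
    qed
  qed (use t in simp)
  also have "fact ?n = edge_weight ?n m * max_slice ?n"
  proof -
    have "fact ?n = fact (Suc m) * fact (?n - Suc m) * (?n choose Suc m)"
      using binomial_fact_lemma[OF h(3)] by (simp only:)
    also have "\<dots> = edge_weight ?n m * (Suc m * (?n choose Suc m))" by (simp add: algebra_simps)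
    finally show ?thesis by (simp only: max_slice_def h(1))
  qed
  finally show ?thesis by simp
qed

text \<open>
  If every weight is at least \<open>c\<close>, an excess found on a part bounds the excess of the whole.
\<close>

lemma excess_mono:
  fixes f :: "'b \<Rightarrow> nat"
  assumes "finite X" "\<forall>x\<in>X. c \<le> f x" "Y \<subseteq> X" "c * card Y + d \<le> sum f Y"
  shows "c * card X + d \<le> sum f X"
proof -
  have "finite Y" using assms finite_subset by blast
  then have "card X = card Y + card (X - Y)" "sum f X = sum f Y + sum f (X - Y)"
    using assms by (simp_all add: card_Diff_subset card_mono sum.subset_diff)
  moreover have "c * card (X - Y) \<le> sum f (X - Y)"
    using sum_bounded_below[of "X - Y" c f] assms(2) by (simp add: mult.commute)
  ultimately show ?thesis using assms(4) by (simp add: distrib_left)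
qed

text \<open>
  In units of 12, the edges of a six-dimensional slice have weight 1, 2 or 10 and the vertices
  weight at least 3, with total 60. With 59 of them there is exactly one of weight 2 and all others
  have weight 1. The exceptional one is an edge between the layers 1 and 2 or between 4 and 5. But
  such edges occur in pairs: an edge from \<open>{p}\<close> to \<open>{p, i}\<close> that is crossed forces
  the one from \<open>{i}\<close> to \<open>{p, i}\<close> to be crossed as well, for otherwise \<open>{i}\<close> or the edge below it
  would contribute a larger weight; the upper layers are symmetric.
\<close>

lemma slice_count_6_ne_59:
  assumes fin: "finite S" and pos: "\<forall>i\<in>S. 0 < a i" and t: "0 < t" "t < sum a S"
    and six: "card S = 6"
  shows "slice_count S a t \<noteq> 59"
proof
  assume count: "slice_count S a t = 59"
  let ?Z = "zeros S a t" and ?C = "crossings S a t"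
  let ?e = "\<lambda>(A, i :: 'a). edge_weight 6 (card A)" and ?v = "\<lambda>A :: 'a set. vertex_weight 6 (card A)"
  have fZ: "finite ?Z" and fC: "finite ?C" using fin finite_slice_sets by auto
  have "(\<Sum>A\<in>?Z. ?v A) + (\<Sum>x\<in>?C. ?e x) = fact 6"
    using chain_identity[OF fin pos t(1)] t six by simp
  then have total: "(\<Sum>A\<in>?Z. ?v A) + (\<Sum>x\<in>?C. ?e x) = 720"
    by (simp add: fact_numeral)
  have count': "card ?Z + card ?C = 59" using count by (simp add: slice_count_def)
  have v36: "36 \<le> ?v A" if "A \<in> ?Z" for A
  proof -
    have "card A \<le> 6" using that fin six by (auto simp: zeros_def dest: card_mono)
    then have "card A \<in> {0,1,2,3,4,5,6}" by auto
    then show ?thesis by (auto simp: fact_numeral)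
  qed
  have lt6: "card (fst x) < 6" if "x \<in> ?C" for x
  proof -
    have "fst x \<subset> S" using that by (auto simp: crossings_def)
    then show ?thesis using psubset_card_mono[OF fin] six by metis
  qed
  have e12: "\<forall>x\<in>?C. 12 \<le> ?e x"
  proof
    fix x assume that: "x \<in> ?C"
    have "card (fst x) \<in> {0,1,2,3,4,5}" using lt6[OF that] by auto
    then show "12 \<le> ?e x" by (cases x) (auto simp: fact_numeral)
  qed
  have vZ: "36 * card ?Z \<le> (\<Sum>A\<in>?Z. ?v A)"
    using sum_bounded_below[of ?Z 36 ?v] v36 by (simp add: mult.commute)
  \<comment> \<open>The total 720 leaves an excess of only 12 over the least conceivable weight 12 for each of 59.\<close>
  have few: False if "Y \<subseteq> ?C" "12 * card Y + 24 \<le> sum ?e Y" for Y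
    using excess_mono[OF fC e12 that] vZ total count' by linarith
  have Z0: "?Z = {}"
  proof (rule ccontr)
    assume "?Z \<noteq> {}"
    then have "0 < card ?Z" using fZ by (simp add: card_gt_0_iff)
    then show False
      using excess_mono[OF fC e12, where Y = "{}" and d = 0] vZ total count' by simp
  qed
  have noend: "card (fst x) \<noteq> 0 \<and> card (fst x) \<noteq> 5" if "x \<in> ?C" for x
  proof -
    have "\<not> 36 \<le> ?e x" using few[of "{x}"] that by auto
    then have "\<not> 36 \<le> edge_weight 6 (card (fst x))" by (cases x) simp
    then show ?thesis
      by (intro conjI notI) (simp_all add: fact_numeral del: card_eq_0_iff)
  qed
  have single: "x = y" if "x \<in> ?C" "y \<in> ?C" "card (fst x) \<in> {1, 4}" "card (fst y) \<in> {1, 4}" for x y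
  proof (rule ccontr)
    assume "x \<noteq> y"
    then show False
      using few[of "{x, y}"] that by (cases x, cases y) (auto simp: fact_numeral)
  qed
  have "\<exists>x\<in>?C. card (fst x) \<in> {1, 4}"
  proof (rule ccontr)
    assume no: "\<not> ?thesis"
    have "?e x = 12" if "x \<in> ?C" for x
    proof -
      have "card (fst x) \<in> {2, 3}" using lt6[OF that] noend[OF that] no that by fastforce
      then show ?thesis by (cases x) (auto simp: fact_numeral)
    qed
    then have "(\<Sum>x\<in>?C. ?e x) = 12 * card ?C" by simp
    then show False using total count' Z0 by simp
  qed
  then obtain A i where Ai: "(A, i) \<in> ?C" "card A = 1 \<or> card A = 4" by auto
  then have A: "A \<subseteq> S" "i \<in> S" "i \<notin> A" "sum a A < t" "t < sum a A + a i"
    by (auto simp: crossings_def)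
  have fA: "finite A" using A fin finite_subset by blast
  from Ai(2) show False
  proof
    assume "card A = 1"
    then obtain p where p: "A = {p}" by (rule card_1_singletonE)
    have "a i \<noteq> t" using Z0 A(2) by (auto simp: zeros_def)
    moreover have "\<not> t < a i"
    proof
      assume "t < a i"
      then have "({}, i) \<in> ?C" using A t by (auto simp: crossings_def)
      then show False using noend[of "({}, i)"] by simp
    qed
    ultimately have "({i}, p) \<in> ?C" using A p by (auto simp: crossings_def)
    then have "({i}, p) = (A, i)" using Ai by (intro single) auto
    then show False using A(3) p by (metis Pair_inject singletonI)
  next
    assume four: "card A = 4"
    have "card (S - insert i A) = 1"
      using A fin fA four six by (simp add: card_Diff_subset)
    then obtain p where p: "S - insert i A = {p}" by (rule card_1_singletonE)
    then have p': "p \<in> S" "p \<notin> A" "p \<noteq> i" "S = insert i (insert p A)" using A by auto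
    have sp: "sum a (insert p A) = a p + sum a A" "sum a S = a i + sum a (insert p A)"
      using p' A fA by auto
    have "sum a (insert p A) \<noteq> t" using Z0 A p' by (auto simp: zeros_def)
    moreover have "\<not> sum a (insert p A) < t"
    proof
      assume "sum a (insert p A) < t"
      then have "(insert p A, i) \<in> ?C" using A p' t sp by (auto simp: crossings_def)
      then show False using noend[of "(insert p A, i)"] four fA p' by simp
    qed
    ultimately have "(A, p) \<in> ?C" using A p' sp by (auto simp: crossings_def)
    then have "(A, p) = (A, i)" using Ai four by (intro single) auto
    then show False using p'(3) by (metis Pair_inject)
  qed
qed

section \<open>The smallest slices\<close>

text \<open>
  For light coordinates the pair of \<open>c\<close>, the slice count, and \<open>b\<close>, the number of sets below the
  hyperplane, is what determines the count after heavy coordinates are added. The first two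
  alternatives are the levels beyond \<open>S\<close> and exactly at \<open>S\<close>. In the third, either the
  balanced bound applies, or some \<open>S - {j}\<close> has value at most \<open>t\<close>; in the latter case the
  proper subsets of \<open>S - {j}\<close> together with \<open>{j}\<close> give \<open>2 ^ (n - 1)\<close> sets below.
\<close>

lemma light_profile:
  assumes fin: "finite S" and pos: "\<forall>i\<in>S. 0 < a i" and t: "0 < t"
    and light: "\<forall>j\<in>S. a j < t"
  defines "n \<equiv> card S" and "c \<equiv> slice_count S a t" and "b \<equiv> card (below S a t)"
  shows "(c = 0 \<and> b = 2 ^ n) \<or> (2 \<le> n \<and> c = 1 \<and> b = 2 ^ n - 1) \<or>
    (2 \<le> n \<and> n \<le> c \<and> c \<le> max_slice n \<and> n + 1 \<le> b \<and> (n * (n - 1) \<le> 2 * c \<or> 2 ^ (n - 1) \<le> b))"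
proof -
  have le: "sum a A \<le> sum a S" if "A \<subseteq> S" for A
    using that fin pos by (intro sum_mono2) (auto intro: less_imp_le)
  have less: "sum a A < sum a S" if "A \<subset> S" for A
    using sum_subset_less[OF fin pos, of S A] that by simp
  have ins: "sum a (insert i A) = a i + sum a A" if "A \<subseteq> S" "i \<in> S" "i \<notin> A" for A i
    using that fin by (meson finite_subset sum.insert)
  consider "sum a S < t" | "sum a S = t" | "t < sum a S" by linarith
  then show ?thesis
  proof cases
    case 1
    then have lt: "sum a A < t" if "A \<subseteq> S" for A using le[OF that] by simp
    have "below S a t = Pow S" using lt by (auto simp: below_def)
    moreover have "zeros S a t = {}" using lt less_irrefl unfolding zeros_def by blast
    moreover have "crossings S a t = {}"
    proof -
      have "\<not> t < sum a A + a i" if "A \<subseteq> S" "i \<in> S" "i \<notin> A" for A i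
        using lt[of "insert i A"] ins[OF that] that by auto
      then show ?thesis by (auto simp: crossings_def)
    qed
    ultimately show ?thesis using fin by (simp add: n_def c_def b_def slice_count_def card_Pow)
  next
    case 2
    have lt: "sum a A < t" if "A \<subset> S" for A using less[OF that] 2 by simp
    have "below S a t = Pow S - {S}" using lt 2 by (auto simp: below_def psubset_eq)
    moreover have "zeros S a t = {S}" using lt 2 less_irrefl unfolding zeros_def psubset_eq by blast
    moreover have "crossings S a t = {}"
    proof -
      have "\<not> t < sum a A + a i" if "A \<subseteq> S" "i \<in> S" "i \<notin> A" for A i
        using le[of "insert i A"] ins[OF that] that 2 by auto
      then show ?thesis by (auto simp: crossings_def)
    qed
    moreover have "2 \<le> n" using light_card_ge_2[OF fin t light, of S] 2 by (simp add: n_def)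
    ultimately show ?thesis using fin by (simp add: n_def c_def b_def slice_count_def card_Pow)
  next
    case 3
    have n: "2 \<le> n" using light_card_ge_2[OF fin t light, of S] 3 by (simp add: n_def)
    have fb: "finite (below S a t)" by (rule finite_slice_sets(4)[OF fin])
    have "n + 1 \<le> b"
    proof -
      have "insert {} ((\<lambda>j. {j}) ` S) \<subseteq> below S a t" using t light by (auto simp: below_def)
      then have "card (insert {} ((\<lambda>j. {j}) ` S)) \<le> b" unfolding b_def by (rule card_mono[OF fb])
      moreover have "card ((\<lambda>j. {j}) ` S) = n" by (simp add: n_def card_image)
      moreover have "{} \<notin> (\<lambda>j. {j}) ` S" by auto
      ultimately show ?thesis using fin by simp
    qed
    moreover have "n * (n - 1) \<le> 2 * c \<or> 2 ^ (n - 1) \<le> b"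
    proof (cases "\<forall>j\<in>S. a j < sum a S - t")
      case True
      then show ?thesis using balanced_slice_count_ge[OF fin pos t 3 light] by (simp add: n_def c_def)
    next
      case False
      then obtain j where j: "j \<in> S" "sum a S - t \<le> a j" by force
      have "sum a (S - {j}) \<le> t" using j fin by (simp add: sum_diff1)
      then have "sum a A < t" if "A \<subset> S - {j}" for A
        using sum_subset_less[OF fin pos, of "S - {j}" A] that by auto
      \<comment> \<open>\<open>S - {j}\<close> itself may lie on the hyperplane; the singleton \<open>{j}\<close> makes up for it.\<close>
      then have "insert {j} (Pow (S - {j}) - {S - {j}}) \<subseteq> below S a t"
        using light j by (auto simp: below_def psubset_eq)
      then have "card (insert {j} (Pow (S - {j}) - {S - {j}})) \<le> b" 
        unfolding b_def by (rule card_mono[OF fb])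
      moreover have "card (insert {j} (Pow (S - {j}) - {S - {j}})) = Suc (2 ^ (n - 1) - 1)"
        using fin j by (subst card_insert_disjoint) (auto simp: card_Pow n_def)
      ultimately show ?thesis by simp
    qed
    ultimately show ?thesis 
      using n light_slice_count_ge[OF fin pos t 3 light] slice_count_le_max[OF fin pos t 3]
      by (simp add: n_def c_def)
  qed
qed

text \<open>
  The values skipped at the lower end, that is all gaps except the value 59 in dimension 6.
\<close>

definition low_gaps :: "nat \<Rightarrow> nat set" where
  "low_gaps n = (if n = 4 then {3, 5} else if n = 5 then {3, 6, 7, 9}
     else if n = 6 then {3, 5, 7, 9, 11, 12}
     else if n = 7 then {3, 5, 6, 9, 10, 11, 13, 14, 15, 18} else {})"

text \<open>
  The common lower bound for \<open>n\<close> light and \<open>m\<close> heavy coordinates: in twice the count,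
  \<open>n (n - 1)\<close> for the light part and twice \<open>n + 1\<close> sets below for each heavy coordinate. The balanced
  alternative of a light profile gives it at once; in the others the powers of 2 outgrow it, with
  \<open>n = 2\<close> being balanced in any case.
\<close>

lemma light_profile_bound:
  fixes n m b c :: nat
  assumes n: "2 \<le> n" "n \<le> 6" and m: "1 \<le> m"
    and profile: "(c = 0 \<and> b = 2 ^ n) \<or> (c = 1 \<and> b = 2 ^ n - 1) \<or>
      (n \<le> c \<and> n + 1 \<le> b \<and> (n * (n - 1) \<le> 2 * c \<or> 2 ^ (n - 1) \<le> b))"
  shows "n * (n - 1) + 2 * (m * (n + 1)) \<le> 2 * (c + m * b)"
proof -
  have n': "n = 2 \<or> n = 3 \<or> n = 4 \<or> n = 5 \<or> n = 6" using n by linarith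
  consider (below) "c = 0" "b = 2 ^ n" | (top) "c = 1" "b = 2 ^ n - 1"
    | (balanced) "n * (n - 1) \<le> 2 * c" "n + 1 \<le> b" | (full) "n \<noteq> 2" "n \<le> c" "2 ^ (n - 1) \<le> b"
    using profile by (cases "n = 2") auto
  then show ?thesis
  proof cases
    case below
    show ?thesis using n' m unfolding below by (elim disjE) simp_all
  next
    case top
    show ?thesis using n' m unfolding top by (elim disjE) simp_all
  next
    case balanced
    then have "n * (n - 1) + 2 * (m * (n + 1)) \<le> 2 * c + 2 * (m * b)"
      by (intro add_mono mult_le_mono2)
    then show ?thesis by (simp only: distrib_left)
  next
    case full
    have "n * (n - 1) + 2 * (m * (n + 1)) \<le> 2 * (n + m * 2 ^ (n - 1))"
      using n' m full(1) by (elim disjE) simp_all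
    also have "\<dots> \<le> 2 * (c + m * b)" using full(2,3) by (intro add_mono mult_le_mono2)
    finally show ?thesis .
  qed
qed

text \<open>
  With no or one light coordinate the count is \<open>n\<close> or \<open>2 (n - 1)\<close>: the slice cuts off a vertex
  or an edge of the cube. With more light coordinates the lower bound passes all gaps, except in
  dimension 7 with two light coordinates, where the counts 16, 17 and 20 are seen directly.
\<close>

lemma heavy_slice_count_not_gap:
  assumes fin: "finite S" and pos: "\<forall>i\<in>S. 0 < a i" and t: "0 < t"
    and heavy: "j \<in> S" "t \<le> a j"
  shows "slice_count S a t \<notin> low_gaps (card S)"
proof -
  define T where "T = {j \<in> S. t \<le> a j}"
  define L where "L = S - T"
  have fT: "finite T" "finite L" and S: "S = L \<union> T" and dis: "L \<inter> T = {}"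
    using fin by (auto simp: T_def L_def)
  let ?c = "slice_count L a t" and ?b = "card (below L a t)" and ?n = "card L" and ?m = "card T"
  have c: "slice_count S a t = ?c + ?m * ?b"
  proof -
    have "\<forall>i\<in>L \<union> T. 0 < a i" "\<And>j. j \<in> T \<Longrightarrow> t \<le> a j"
      using pos by (auto simp: T_def L_def)
    from slice_count_heavy[OF fT(2,1) dis this(1) t this(2)] show ?thesis using S by simp
  qed
  have n: "card S = ?n + ?m" using S dis fT by (simp add: card_Un_disjoint)
  have m: "0 < ?m" using heavy fT by (auto simp: card_gt_0_iff T_def)
  have p: "(?c = 0 \<and> ?b = 2 ^ ?n) \<or> (2 \<le> ?n \<and> ?c = 1 \<and> ?b = 2 ^ ?n - 1) \<or>
    (2 \<le> ?n \<and> ?n \<le> ?c \<and> ?c \<le> max_slice ?n \<and> ?n + 1 \<le> ?b \<and>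
      (?n * (?n - 1) \<le> 2 * ?c \<or> 2 ^ (?n - 1) \<le> ?b))"
    by (rule light_profile[OF fT(2) _ t]) (use pos in \<open>auto simp: L_def T_def\<close>)
  have max2: "max_slice 2 = 2" by (simp add: max_slice_def)
  show ?thesis
  proof (cases "card S \<in> {4, 5, 6, 7}")
    case False
    then show ?thesis by (simp add: low_gaps_def)
  next
    case size: True
    consider "?n = 0" | "?n = 1" | "2 \<le> ?n" by linarith
    then show ?thesis
    proof cases
      case 1
      then have "slice_count S a t = card S" using p c n by simp
      then show ?thesis using size by (auto simp: low_gaps_def)
    next
      case 2
      then have "slice_count S a t = 2 * (card S - 1)" using p c n by simp
      then show ?thesis using size by (auto simp: low_gaps_def)
    next
      case 3
      have "?n \<le> 6" using size n m by auto
      then have ge: "?n * (?n - 1) + 2 * (?m * (?n + 1)) \<le> 2 * slice_count S a t"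
        unfolding c by (rule light_profile_bound[OF 3]) (use m p in auto)
      show ?thesis
      proof (cases "?n = 2 \<and> card S = 7")
        case True
        \<comment> \<open>With \<open>c = 2\<close> the count is 2 modulo 5, which 18 is not.\<close>
        then have "?c + 5 * ?b = 20 \<or> ?c + 5 * ?b = 16 \<or> ?c = 2" using p max2 by auto
        moreover have "slice_count S a t = ?c + 5 * ?b" using c n True by simp
        moreover have "16 \<le> slice_count S a t" using ge n True by simp
        ultimately have "16 \<le> slice_count S a t" "slice_count S a t \<noteq> 18" by presburger+
        then show ?thesis using True by (auto simp: low_gaps_def)
      next
        case False
        have "(card S = 4 \<and> 7 \<le> slice_count S a t) \<or> (card S = 5 \<and> 10 \<le> slice_count S a t) \<or>
          (card S = 6 \<and> 13 \<le> slice_count S a t) \<or> (card S = 7 \<and> 19 \<le> slice_count S a t)"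
        proof -
          have "?n = 2 \<or> ?n = 3 \<or> ?n = 4 \<or> ?n = 5 \<or> ?n = 6" using 3 \<open>?n \<le> 6\<close> by linarith
          then show ?thesis
            using ge size n m False by (elim disjE) auto
        qed
        then show ?thesis by (auto simp: low_gaps_def)
      qed
    qed
  qed
qed

text \<open>
  If no coordinate is heavy for \<open>t\<close>, one may be heavy for the dual level, which has the same
  count. If there is none for either level, the balanced bound \<open>n (n - 1) / 2\<close> is beyond all gaps.
\<close>

lemma proper_slice_count_not_low_gap:
  assumes fin: "finite S" and pos: "\<forall>i\<in>S. 0 < a i" and t: "0 < t" "t < sum a S"
  shows "slice_count S a t \<notin> low_gaps (card S)"
proof -
  consider j where "j \<in> S" "t \<le> a j" | j where "j \<in> S" "sum a S - t \<le> a j"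
    | "\<forall>j\<in>S. a j < t" "\<forall>j\<in>S. a j < sum a S - t" by (meson not_le)
  then show ?thesis
  proof cases
    case 1
    then show ?thesis using heavy_slice_count_not_gap[OF fin pos t(1)] by blast
  next
    case 2
    then show ?thesis
      using heavy_slice_count_not_gap[OF fin pos, of "sum a S - t"] t slice_count_dual[OF fin, of a t] by auto
  next
    case 3
    then have "card S * (card S - 1) \<le> 2 * slice_count S a t"
      by (rule balanced_slice_count_ge[OF fin pos t])
    then show ?thesis by (auto simp: low_gaps_def)
  qed
qed

section \<open>All slice counts in dimension at most 7\<close>

definition slice_values :: "nat \<Rightarrow> nat set" where
  "slice_values n = {1..max_slice n} - low_gaps n - (if n = 6 then {59} else {})"

lemma max_slice_numerals:
  "max_slice (Suc 0) = 1" "max_slice 2 = 2" "max_slice 3 = 6" "max_slice 4 = 12"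
  "max_slice 5 = 30" "max_slice 6 = 60" "max_slice 7 = 140"
  by (simp_all add: max_slice_def binomial_code fold_atLeastAtMost_nat.simps fact_numeral)

lemma double_slice_values:
  assumes "1 \<le> n" "n \<le> 6" "v \<in> slice_values n"
  shows "2 * v \<in> slice_values (Suc n)"
proof -
  note unfold = slice_values_def low_gaps_def max_slice_numerals
  consider "n = 1" | "n = 2" | "n = 3" | "n = 4" | "n = 5" | "n = 6" using assms by linarith
  then show ?thesis
  proof cases
    case 1
    then show ?thesis using assms(3) max_slice_numerals(2) by (simp add: unfold numeral_2_eq_2)
  next
    case 2
    then show ?thesis using assms(3) by (simp add: unfold)
  qed (use assms(3) in \<open>simp add: unfold; presburger\<close>)+
qed

text \<open>
  Coordinates with coefficient 0 are removed one at a time, each halving the count; the sets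
  of values are closed under the corresponding doubling. For positive coefficients the
  hyperplane either touches the cube in a single vertex or cuts it properly.
\<close>

lemma slice_count_in_slice_values:
  assumes "finite S" "1 \<le> card S" "card S \<le> 7" "\<forall>i\<in>S. 0 \<le> a i" "\<exists>i\<in>S. a i \<noteq> 0"
    "0 \<le> t" "t \<le> sum a S"
  shows "slice_count S a t \<in> slice_values (card S)"
  using assms
proof (induction "card S" arbitrary: S)
  case 0 then show ?case by simp
next
  case (Suc n)
  have one: "1 \<in> slice_values (card S)"
  proof -
    have "card S = 1 \<or> card S = 2 \<or> card S = 3 \<or> card S = 4 \<or> card S = 5 \<or> card S = 6 \<or> card S = 7" 
      using Suc.prems by linarith
    then show ?thesis
      by (elim disjE) (simp_all add: slice_values_def low_gaps_def max_slice_numerals)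
  qed
  show ?case
  proof (cases "\<exists>j\<in>S. a j = 0")
    case True
    then obtain j where j: "j \<in> S" "a j = 0" by blast
    let ?R = "S - {j}"
    have R: "finite ?R" "card ?R = n" "S = insert j ?R" "j \<notin> ?R" "sum a ?R = sum a S"
      using Suc.prems(1) Suc.hyps(2) j by (auto simp: sum_diff1)
    have nz: "\<exists>i\<in>?R. a i \<noteq> 0" using Suc.prems(5) j by auto
    then have "1 \<le> n" using R by (metis One_nat_def Suc_leI card_gt_0_iff equals0D)
    then have "slice_count ?R a t \<in> slice_values n"
      using Suc.hyps(1)[of ?R] R nz Suc.prems Suc.hyps(2) by simp
    moreover have "slice_count S a t = 2 * slice_count ?R a t"
      using slice_count_insert_zero[of ?R j a t] R j(2) by metis
    ultimately show ?thesis
      using double_slice_values[OF \<open>1 \<le> n\<close>] Suc.hyps(2) Suc.prems by simp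
  next
    case False
    then have pos: "\<forall>i\<in>S. 0 < a i" using Suc.prems(4) by force
    consider "t = 0" | "t = sum a S" | "0 < t" "t < sum a S" using Suc.prems by linarith
    then show ?thesis
    proof cases
      case 1
      then show ?thesis using slice_count_zero[OF Suc.prems(1) pos] one by simp
    next
      case 2
      then show ?thesis 
        using slice_count_zero[OF Suc.prems(1) pos] slice_count_dual[OF Suc.prems(1), of a 0] one by simp
    next
      case 3
      note h = Suc.prems(1) pos 3
      have "slice_count S a t \<noteq> 0"
        using chain_identity[OF h(1-3)] 3 h(1) by (auto simp: slice_count_def finite_slice_sets)
      then show ?thesis
        using slice_count_le_max[OF h] proper_slice_count_not_low_gap[OF h] slice_count_6_ne_59[OF h]
        by (auto simp: slice_values_def)
    qed
  qed
qed

section \<open>Vertices of slices of the cube in Euclidean space\<close>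

text \<open>
  A point of a slice is a vertex of it iff it has at most one fractional coordinate, and the
  coefficient of that coordinate is not 0 (the slice then cuts the cube edge transversally).
\<close>

definition slice_points :: "real ^ 'n \<Rightarrow> real \<Rightarrow> (real ^ 'n) set" where
  "slice_points a b = {x. (\<forall>i. 0 \<le> x $ i \<and> x $ i \<le> 1) \<and> a \<bullet> x = b \<and>
     (\<forall>i j. 0 < x $ i \<and> x $ i < 1 \<longrightarrow> 0 < x $ j \<and> x $ j < 1 \<longrightarrow> i = j \<and> a $ i \<noteq> 0)}"

lemma hypercube_eq: "hypercube = {x :: real ^ 'n. \<forall>i. 0 \<le> x $ i \<and> x $ i \<le> 1}"
proof -
  have "{x :: real ^ 'n. \<forall>i. x $ i = 0 \<or> x $ i = 1} = {x. \<forall>i\<in>Basis. x \<bullet> i = 0 \<or> x \<bullet> i = 1}"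
    by (auto simp: Basis_vec_def inner_axis)
  then have "hypercube = cbox (0 :: real ^ 'n) One"
    unfolding hypercube_def by (simp only: unit_interval_convex_hull)
  moreover have "x \<in> cbox 0 One \<longleftrightarrow> (\<forall>i\<in>Basis. 0 \<le> x \<bullet> i \<and> x \<bullet> i \<le> 1)" for x :: "real ^ 'n"
    by (simp add: mem_box)
  ultimately show ?thesis by (auto simp: Basis_vec_def inner_axis)
qed

lemma inner_vec_sum: "a \<bullet> x = (\<Sum>i\<in>UNIV. a $ i * x $ i)" for a x :: "real ^ 'n"
  by (simp add: inner_vec_def)

text \<open>
  A direction that lies in the hyperplane and moves fractional coordinates only can be followed
  a little both ways inside the slice.
\<close>

lemma not_extreme_of_direction:
  fixes x :: "real ^ 'n"
  assumes x: "a \<bullet> x = b" "\<forall>i. 0 \<le> x $ i \<and> x $ i \<le> 1"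
    and d: "d \<noteq> 0" "a \<bullet> d = 0" "\<forall>i. d $ i \<noteq> 0 \<longrightarrow> 0 < x $ i \<and> x $ i < 1"
  shows "\<not> x extreme_point_of ({x. a \<bullet> x = b} \<inter> hypercube)"
proof
  assume ext: "x extreme_point_of ({x. a \<bullet> x = b} \<inter> hypercube)"
  \<comment> \<open>The longest step along \<open>d\<close>, in both directions, that keeps all coordinates in the unit interval.\<close>
  define F where "F = {i. d $ i \<noteq> 0}"
  define e where "e = Min ((\<lambda>i. min (x $ i) (1 - x $ i) / \<bar>d $ i\<bar>) ` F)"
  have F: "finite F" "F \<noteq> {}" using d(1) by (auto simp: F_def vec_eq_iff)
  have e: "0 < e" unfolding e_def using F d(3) by (subst Min_gr_iff) (auto simp: F_def)
  have bound: "e * \<bar>d $ i\<bar> \<le> min (x $ i) (1 - x $ i)" for i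
  proof (cases "i \<in> F")
    case True
    then have "e \<le> min (x $ i) (1 - x $ i) / \<bar>d $ i\<bar>" unfolding e_def using F by (intro Min_le) auto
    then show ?thesis using True by (simp add: F_def pos_le_divide_eq)
  next
    case False
    then show ?thesis using x(2) by (simp add: F_def)
  qed
  have "\<bar>e * d $ i\<bar> \<le> min (x $ i) (1 - x $ i)" for i
    using bound[of i] e by (simp add: abs_mult)
  then have "\<bar>e * d $ i\<bar> \<le> x $ i" "\<bar>e * d $ i\<bar> \<le> 1 - x $ i" for i
    by (metis min.bounded_iff)+
  note h = this
  have range: "0 \<le> x $ i + e * d $ i \<and> x $ i + e * d $ i \<le> 1 \<and>
      0 \<le> x $ i - e * d $ i \<and> x $ i - e * d $ i \<le> 1" for i
    using h[of i] by linarith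
  have "x - e *\<^sub>R d \<in> {x. a \<bullet> x = b} \<inter> hypercube" "x + e *\<^sub>R d \<in> {x. a \<bullet> x = b} \<inter> hypercube"
    using range x d by (simp_all add: hypercube_eq inner_diff_right inner_add_right)
  moreover have "x \<in> open_segment (x - e *\<^sub>R d) (x + e *\<^sub>R d)"
  proof -
    have "x - e *\<^sub>R d \<noteq> x + e *\<^sub>R d" using e d(1) by (simp add: algebra_simps flip: scaleR_2)
    moreover have "midpoint (x - e *\<^sub>R d) (x + e *\<^sub>R d) = x" by (simp add: midpoint_def flip: scaleR_2)
    ultimately show ?thesis by (metis midpoint_in_open_segment)
  qed
  ultimately show False using ext by (simp add: extreme_point_of_def)
qed

lemma vertices_slice:
  fixes a :: "real ^ 'n"
  shows "vertices ({x. a \<bullet> x = b} \<inter> hypercube) = slice_points a b"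
proof (intro equalityI subsetI)
  fix x assume "x \<in> vertices ({x. a \<bullet> x = b} \<inter> hypercube)"
  then have ext: "x extreme_point_of ({x. a \<bullet> x = b} \<inter> hypercube)" by (simp add: vertices_def)
  then have x: "a \<bullet> x = b" "\<forall>i. 0 \<le> x $ i \<and> x $ i \<le> 1"
    by (auto simp: extreme_point_of_def hypercube_eq)
  have "i = j \<and> a $ i \<noteq> 0" if f: "0 < x $ i" "x $ i < 1" "0 < x $ j" "x $ j < 1" for i j
  proof (rule ccontr)
    assume no: "\<not> (i = j \<and> a $ i \<noteq> 0)"
    \<comment> \<open>A direction supported on \<open>i\<close> and \<open>j\<close> that lies in the hyperplane.\<close>
    define d :: "real ^ 'n" where "d = (if a $ i = 0 then axis i 1 else a $ j *\<^sub>R axis i 1 - a $ i *\<^sub>R axis j 1)"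
    have "a \<bullet> d = 0" by (simp add: d_def inner_diff_right inner_axis)
    moreover have "d \<noteq> 0"
    proof (cases "a $ i = 0")
      case True
      then have "d $ i \<noteq> 0" by (simp add: d_def axis_def)
      then show ?thesis by auto
    next
      case False
      then have "d $ j \<noteq> 0" using no by (auto simp: d_def axis_def)
      then show ?thesis by auto
    qed
    moreover have "\<forall>k. d $ k \<noteq> 0 \<longrightarrow> 0 < x $ k \<and> x $ k < 1"
      using f by (auto simp: d_def axis_def split: if_splits)
    ultimately show False using not_extreme_of_direction[OF x] ext by blast
  qed
  then show "x \<in> slice_points a b" using x unfolding slice_points_def by blast
next
  fix x assume "x \<in> slice_points a b"
  note mem = this[unfolded slice_points_def mem_Collect_eq]
  note x = conjunct1[OF mem] conjunct1[OF conjunct2[OF mem]]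
  have one: "i = j \<and> a $ i \<noteq> 0" if "0 < x $ i \<and> x $ i < 1" "0 < x $ j \<and> x $ j < 1" for i j
    using conjunct2[OF conjunct2[OF mem]] that by blast
  have False if y: "a \<bullet> y = b" "y \<in> hypercube" and z: "a \<bullet> z = b" "z \<in> hypercube"
    and seg: "x \<in> open_segment y z" for y z
  proof -
    obtain u where u: "y \<noteq> z" "0 < u" "u < 1" "x = (1 - u) *\<^sub>R y + u *\<^sub>R z"
      using seg by (auto simp: in_segment(2))
    have fixed: "0 < x $ k \<and> x $ k < 1" if "y $ k \<noteq> z $ k" for k
    proof -
      have r: "0 \<le> y $ k" "y $ k \<le> 1" "0 \<le> z $ k" "z $ k \<le> 1" using y z by (auto simp: hypercube_eq)
      have xk: "x $ k = (1 - u) * y $ k + u * z $ k" using u by simp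
      have "0 < (1 - u) * y $ k \<or> 0 < u * z $ k" using that r u by (auto simp: zero_less_mult_iff)
      moreover have "0 \<le> (1 - u) * y $ k" "0 \<le> u * z $ k" using r u by auto
      moreover have "0 < (1 - u) * (1 - y $ k) \<or> 0 < u * (1 - z $ k)" 
        using that r u by (auto simp: zero_less_mult_iff)
      moreover have "0 \<le> (1 - u) * (1 - y $ k)" "0 \<le> u * (1 - z $ k)" using r u by auto
      moreover have "1 - x $ k = (1 - u) * (1 - y $ k) + u * (1 - z $ k)" 
        unfolding xk by (simp add: algebra_simps)
      ultimately show ?thesis using xk by linarith
    qed
    obtain k where k: "y $ k \<noteq> z $ k" using u(1) by (auto simp: vec_eq_iff)
    have same: "y $ l = z $ l" if "l \<noteq> k" for l
      using one[OF fixed fixed[OF k], of l] that by blast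
    have "(\<Sum>l\<in>UNIV. a $ l * (y $ l - z $ l)) = 0"
      using y(1) z(1) by (simp add: inner_vec_sum algebra_simps sum_subtractf)
    moreover have "(\<Sum>l\<in>UNIV. a $ l * (y $ l - z $ l)) = (\<Sum>l\<in>{k}. a $ l * (y $ l - z $ l))"
      by (rule sum.mono_neutral_right) (use same in auto)
    ultimately show False using k one[OF fixed[OF k] fixed[OF k]] by simp
  qed
  then show "x \<in> vertices ({x. a \<bullet> x = b} \<inter> hypercube)"
    using x(1,2) by (auto simp: vertices_def extreme_point_of_def hypercube_eq)
qed

text \<open>
  Reflecting the coordinates with negative coefficient reduces slices to those with
  coefficients \<open>\<bar>a\<^sub>i\<bar>\<close>; the level moves by the total weight of the reflected coordinates.
\<close>

definition flip :: "real ^ 'n \<Rightarrow> real ^ 'n \<Rightarrow> real ^ 'n" where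
  "flip a x = (\<chi> i. if a $ i < 0 then 1 - x $ i else x $ i)"

definition flip_level :: "real ^ 'n \<Rightarrow> real \<Rightarrow> real" where
  "flip_level a b = b + (\<Sum>i\<in>UNIV. if a $ i < 0 then - a $ i else 0)"

lemma inner_flip:
  "(\<chi> i. \<bar>a $ i\<bar>) \<bullet> flip a x = flip_level a (a \<bullet> x)" for a x :: "real ^ 'n"
  unfolding flip_level_def inner_vec_sum sum.distrib[symmetric]
  by (rule sum.cong) (auto simp: flip_def algebra_simps)

lemma flip_slice_points:
  "bij_betw (flip a) (slice_points a b) (slice_points (\<chi> i. \<bar>a $ i\<bar>) (flip_level a b))"
proof -
  have inv: "flip a (flip a x) = x" for x by (simp add: flip_def vec_eq_iff)
  have frac: "0 < flip a x $ i \<and> flip a x $ i < 1 \<longleftrightarrow> 0 < x $ i \<and> x $ i < 1"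
    and range: "0 \<le> flip a x $ i \<and> flip a x $ i \<le> 1 \<longleftrightarrow> 0 \<le> x $ i \<and> x $ i \<le> 1" for x i
    by (auto simp: flip_def)
  have lev: "flip_level a c = flip_level a b \<longleftrightarrow> c = b" for c by (simp add: flip_level_def)
  have mem: "flip a x \<in> slice_points (\<chi> i. \<bar>a $ i\<bar>) (flip_level a b) \<longleftrightarrow> x \<in> slice_points a b" for x
    unfolding slice_points_def mem_Collect_eq frac range inner_flip lev by simp
  show ?thesis
  proof (rule bij_betw_byWitness[where f' = "flip a"])
    show "flip a ` slice_points (\<chi> i. \<bar>a $ i\<bar>) (flip_level a b) \<subseteq> slice_points a b"
      using mem[of "flip a _"] by (auto simp: inv)
  qed (use inv mem in auto)
qed

definition vertex_point :: "'n set \<Rightarrow> real ^ 'n" where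
  "vertex_point A = (\<chi> k. if k \<in> A then 1 else 0)"

definition edge_point :: "('n \<Rightarrow> real) \<Rightarrow> real \<Rightarrow> 'n set \<times> 'n \<Rightarrow> real ^ 'n" where
  "edge_point c t = (\<lambda>(A, i). \<chi> k. if k = i then (t - sum c A) / c i else if k \<in> A then 1 else 0)"

lemma inner_indicator_off:
  fixes x :: "real ^ 'n"
  assumes "\<forall>k. k \<notin> I \<longrightarrow> x $ k = (if k \<in> A then 1 else 0)" "A \<inter> I = {}"
  shows "(\<chi> i. c i) \<bullet> x = sum c A + (\<Sum>k\<in>I. c k * x $ k)"
proof -
  have "(\<chi> i. c i) \<bullet> x = (\<Sum>k\<in>UNIV - I. c k * x $ k) + (\<Sum>k\<in>I. c k * x $ k)"
    unfolding inner_vec_sum by (simp add: sum.subset_diff[of I UNIV])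
  also have "(\<Sum>k\<in>UNIV - I. c k * x $ k) = (\<Sum>k\<in>UNIV - I. if k \<in> A then c k else 0)"
    by (rule sum.cong) (use assms in auto)
  also have "\<dots> = sum c A"
    using assms(2) by (subst sum.inter_restrict[symmetric]) (auto intro!: sum.cong)
  finally show ?thesis .
qed

text \<open>
  The slice vertex on a crossed edge \<open>A\<close> -- \<open>insert i A\<close> has \<open>(t - sum c A) / c i\<close> as its
  fractional coordinate. The sets and edges can be read off from the slice vertices:
  \<open>A\<close> consists of the coordinates equal to 1, and \<open>i\<close> is the fractional one.
\<close>

lemma card_slice_points_nonneg:
  fixes c :: "'n::finite \<Rightarrow> real"
  assumes c: "\<forall>i. 0 \<le> c i"
  shows "card (slice_points (\<chi> i. c i) t) = slice_count UNIV c t"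
proof -
  let ?Z = "zeros UNIV c t" and ?C = "crossings UNIV c t"
  have inner_v: "(\<chi> i. c i) \<bullet> vertex_point A = sum c A" for A
    using inner_indicator_off[of "{}" "vertex_point A" A c] by (simp add: vertex_point_def)
  have C: "i \<notin> A" "0 < c i" "0 < (t - sum c A) / c i" "(t - sum c A) / c i < 1" if "(A, i) \<in> ?C" for A i
    using that by (auto simp: crossings_def divide_simps)
  have inner_e: "(\<chi> i. c i) \<bullet> edge_point c t (A, i) = t" if "(A, i) \<in> ?C" for A i
    using inner_indicator_off[of "{i}" "edge_point c t (A, i)" A c] C[OF that] by (simp add: edge_point_def)
  have eq: "slice_points (\<chi> i. c i) t = vertex_point ` ?Z \<union> edge_point c t ` ?C"
  proof (intro equalityI subsetI)
    fix x assume x: "x \<in> slice_points (\<chi> i. c i) t"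
    define A where "A = {k. x $ k = 1}"
    have r: "0 \<le> x $ k" "x $ k \<le> 1" for k using x by (auto simp: slice_points_def)
    show "x \<in> vertex_point ` ?Z \<union> edge_point c t ` ?C"
    proof (cases "\<exists>i. 0 < x $ i \<and> x $ i < 1")
      case False
      then have "x $ k = 0 \<or> x $ k = 1" for k using r[of k] by (metis order_le_less)
      then have "x = vertex_point A" by (auto simp: A_def vertex_point_def vec_eq_iff)
      moreover from this have "A \<in> ?Z" using inner_v[of A] x by (simp add: zeros_def slice_points_def)
      ultimately show ?thesis by blast
    next
      case True
      then obtain i where i: "0 < x $ i" "x $ i < 1" by blast
      have off: "x $ k = (if k \<in> A then 1 else 0)" if "k \<noteq> i" for k
      proof -
        have "\<not> (0 < x $ k \<and> x $ k < 1)" using x i that unfolding slice_points_def by blast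
        then show ?thesis using r[of k] by (auto simp: A_def)
      qed
      have "c i \<noteq> 0" using x i by (fastforce simp: slice_points_def)
      then have ci: "0 < c i" using c by (simp add: less_le)
      have iA: "i \<notin> A" using i by (simp add: A_def)
      have t: "t = sum c A + c i * x $ i"
        using inner_indicator_off[of "{i}" x A c] off iA x by (simp add: slice_points_def)
      have "(A, i) \<in> ?C" using iA ci i t by (simp add: crossings_def)
      moreover have "x = edge_point c t (A, i)"
        using off t ci by (auto simp: edge_point_def vec_eq_iff)
      ultimately show ?thesis by blast
    qed
  next
    fix x assume "x \<in> vertex_point ` ?Z \<union> edge_point c t ` ?C"
    then consider A where "A \<in> ?Z" "x = vertex_point A" | A i where "(A, i) \<in> ?C" "x = edge_point c t (A, i)"
      by auto
    then show "x \<in> slice_points (\<chi> i. c i) t"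
    proof cases
      case 1
      then show ?thesis using inner_v[of A]
        by (auto simp: slice_points_def zeros_def vertex_point_def split: if_splits)
    next
      case 2
      show ?thesis unfolding slice_points_def mem_Collect_eq
      proof (intro conjI allI impI)
        show "(\<chi> i. c i) \<bullet> x = t" using inner_e 2 by simp
      qed (use C[OF 2(1)] 2(2) in \<open>auto simp: edge_point_def split: if_splits\<close>)
    qed
  qed
  have inj_v: "inj_on vertex_point ?Z"
  proof (rule inj_onI)
    fix A B :: "'n set" assume "vertex_point A = vertex_point B"
    then have "\<forall>k. (k \<in> A) = (k \<in> B)" by (auto simp: vertex_point_def vec_eq_iff split: if_splits)
    then show "A = B" by blast
  qed
  have edge_i: "0 < edge_point c t (A, i) $ k \<and> edge_point c t (A, i) $ k < 1 \<longleftrightarrow> k = i"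
    and edge_A: "edge_point c t (A, i) $ k = 1 \<longleftrightarrow> k \<in> A" if "(A, i) \<in> ?C" for A i k
    using C[OF that] by (auto simp: edge_point_def)
  have inj_e: "inj_on (edge_point c t) ?C"
  proof (rule inj_onI, clarify)
    fix A i B j assume h: "(A, i) \<in> ?C" "(B, j) \<in> ?C" "edge_point c t (A, i) = edge_point c t (B, j)"
    have "\<forall>k. k = i \<longleftrightarrow> k = j" using edge_i[OF h(1)] edge_i[OF h(2)] h(3) by simp
    moreover have "\<forall>k. k \<in> A \<longleftrightarrow> k \<in> B" using edge_A[OF h(1)] edge_A[OF h(2)] h(3) by simp
    ultimately show "A = B \<and> i = j" by blast
  qed
  have "vertex_point ` ?Z \<inter> edge_point c t ` ?C = {}"
  proof -
    have "vertex_point B \<noteq> edge_point c t (A, i)" if "(A, i) \<in> ?C" for A B i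
    proof
      assume "vertex_point B = edge_point c t (A, i)"
      then have "0 < vertex_point B $ i \<and> vertex_point B $ i < 1" using edge_i[OF that, of i] by simp
      then show False by (simp add: vertex_point_def split: if_splits)
    qed
    then show ?thesis by auto
  qed
  then show ?thesis
    unfolding eq slice_count_def
    by (simp add: card_Un_disjoint finite_slice_sets card_image inj_v inj_e)
qed

lemma VSS_hypercube_subset:
  assumes "CARD('n) \<le> 7"
  shows "VSS (hypercube :: (real ^ 'n) set) \<subseteq> slice_values CARD('n)"
proof
  fix v assume "v \<in> VSS (hypercube :: (real ^ 'n) set)"
  then obtain H :: "(real ^ 'n) set" where H: "affine_hyperplane H" "H \<inter> hypercube \<noteq> {}"
    and vH: "v = card (vertices (H \<inter> hypercube))"
    unfolding VSS_def meeting_hyperplanes_def slice_vertex_count_def by blast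
  then obtain a b where a: "a \<noteq> 0" and Hab: "H = {x. a \<bullet> x = b}" unfolding affine_hyperplane_def by blast
  then obtain x where x: "a \<bullet> x = b" "x \<in> hypercube" using H(2) by blast
  have v: "v = card (vertices ({x. a \<bullet> x = b} \<inter> hypercube))" using vH Hab by simp
  let ?c = "\<lambda>i. \<bar>a $ i\<bar>" and ?t = "flip_level a b"
  have "v = card (slice_points a b)" by (simp add: v vertices_slice)
  also have "\<dots> = card (slice_points (\<chi> i. ?c i) ?t)"
    by (rule bij_betw_same_card[OF flip_slice_points])
  also have "\<dots> = slice_count UNIV ?c ?t" by (rule card_slice_points_nonneg) simp
  finally have "v = slice_count UNIV ?c ?t" .
  moreover have "?t = (\<Sum>i\<in>UNIV. ?c i * flip a x $ i)"
    using inner_flip[of a x] x by (simp add: inner_vec_sum)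
  moreover have r: "0 \<le> flip a x $ i \<and> flip a x $ i \<le> 1" for i
    using x(2) by (auto simp: hypercube_eq flip_def)
  ultimately have "v = slice_count UNIV ?c ?t" "0 \<le> ?t" "?t \<le> sum ?c UNIV"
    by (auto intro!: sum_nonneg sum_mono mult_left_le)
  moreover have "\<exists>i\<in>UNIV. ?c i \<noteq> 0" using a by (auto simp: vec_eq_iff)
  ultimately show "v \<in> slice_values CARD('n)"
    using slice_count_in_slice_values[of UNIV ?c ?t] assms by (simp add: Suc_leI)
qed

lemma slice_count_in_VSS:
  fixes c :: "'n::finite \<Rightarrow> real"
  assumes "\<forall>i. 0 \<le> c i" "c j \<noteq> 0" "slice_count UNIV c t \<noteq> 0"
  shows "slice_count UNIV c t \<in> VSS (hypercube :: (real ^ 'n) set)"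
proof -
  let ?H = "{x. (\<chi> i. c i) \<bullet> x = t}"
  have card: "slice_count UNIV c t = card (slice_points (\<chi> i. c i) t)"
    using card_slice_points_nonneg[OF assms(1)] by simp
  then have "slice_points (\<chi> i. c i) t \<noteq> {}" using assms(3) by auto
  then have "?H \<inter> hypercube \<noteq> {}" by (auto simp: slice_points_def hypercube_eq)
  moreover have "(\<chi> i. c i) \<noteq> 0" using assms(2) by (auto simp: vec_eq_iff)
  ultimately have "?H \<in> meeting_hyperplanes hypercube"
    by (auto simp: meeting_hyperplanes_def affine_hyperplane_def)
  moreover have "slice_vertex_count hypercube ?H = slice_count UNIV c t"
    by (simp add: slice_vertex_count_def vertices_slice card)
  ultimately show ?thesis unfolding VSS_def by (metis imageI)
qed

section \<open>Realizing the remaining values\<close>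

text \<open>
  The recursion for adding a coordinate, executed on a list of integer weights.
\<close>

fun band_num :: "int list \<Rightarrow> int \<Rightarrow> int \<Rightarrow> int" where
  "band_num [] l u = (if l < 0 \<and> 0 < u then 1 else 0)"
| "band_num (w # ws) l u = band_num ws l u + band_num ws (l - w) (u - w)"

fun slice_num :: "int list \<Rightarrow> int \<Rightarrow> int" where
  "slice_num [] t = (if t = 0 then 1 else 0)"
| "slice_num (w # ws) t = slice_num ws t + slice_num ws (t - w) + band_num ws (t - w) t"

lemma slice_num_realised:
  assumes "finite S" "length ws = card S"
  shows "\<exists>c. c ` S = real_of_int ` set ws \<and>
    (\<forall>l u. int (card (band S c (of_int l) (of_int u))) = band_num ws l u) \<and>
    (\<forall>t. int (slice_count S c (of_int t)) = slice_num ws t)"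
  using assms
proof (induction ws arbitrary: S)
  case Nil
  then show ?case by (simp add: slice_count_empty band_empty)
next
  case (Cons w ws)
  then obtain j R where S: "S = insert j R" "j \<notin> R" "card R = length ws"
    by (metis card_Suc_eq length_Cons)
  then have R: "finite R" using Cons.prems by simp
  obtain c where c: "c ` R = real_of_int ` set ws"
    "\<And>l u. int (card (band R c (of_int l) (of_int u))) = band_num ws l u"
    "\<And>t. int (slice_count R c (of_int t)) = slice_num ws t"
    using Cons.IH[OF R] S(3) by auto
  let ?c = "c(j := of_int w)"
  have eq: "sum ?c A = sum c A" if "A \<subseteq> R" for A
    using that S(2) by (intro sum.cong) auto
  have b: "band R ?c l u = band R c l u" for l u
    using eq by (auto simp: band_def)
  have "zeros R ?c t = zeros R c t" "crossings R ?c t = crossings R c t" for t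
    using eq S(2) by (auto simp: zeros_def crossings_def)
  then have s: "slice_count R ?c t = slice_count R c t" for t by (simp add: slice_count_def)
  show ?case
  proof (intro exI[of _ ?c] conjI allI)
    have "?c ` R = c ` R" using S(2) by (intro image_cong) auto
    then show "?c ` S = real_of_int ` set (w # ws)"
      by (simp only: S(1) c(1) image_insert fun_upd_same list.set)
  next
    fix l u
    show "int (card (band S ?c (of_int l) (of_int u))) = band_num (w # ws) l u"
      using band_insert[OF R S(2), of ?c "of_int l" "of_int u"] c(2)[of l u] c(2)[of "l - w" "u - w"]
      by (simp add: S(1) b)
  next
    fix t
    show "int (slice_count S ?c (of_int t)) = slice_num (w # ws) t"
      using slice_count_insert[OF R S(2), of ?c "of_int t"] c(3)[of t] c(3)[of "t - w"] c(2)[of "t - w" t]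
      by (simp add: S(1) b s)
  qed
qed

text \<open>
  A sample is a list of weight vectors, each with the list of levels at which it is cut.
\<close>

definition sampled :: "(int list \<times> int list) list \<Rightarrow> int list" where
  "sampled W = concat (map (\<lambda>(ws, ts). map (slice_num ws) ts) W)"

definition certifies :: "nat \<Rightarrow> (int list \<times> int list) list \<Rightarrow> int list \<Rightarrow> bool" where
  "certifies n W vs \<longleftrightarrow>
     list_all (\<lambda>(ws, ts). length ws = n \<and> list_all (\<lambda>w. 0 \<le> w) ws \<and> list_ex (\<lambda>w. 0 < w) ws) W \<and>
     set vs \<subseteq> set (sampled W)"

lemma certifies_VSS:
  assumes cert: "certifies CARD('n) W vs" and v: "int v \<in> set vs" "v \<noteq> 0"
  shows "v \<in> VSS (hypercube :: (real ^ 'n) set)"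
proof -
  obtain ws ts t where W: "(ws, ts) \<in> set W" "t \<in> set ts" "int v = slice_num ws t"
    using cert v by (auto simp: certifies_def sampled_def)
  then have ws: "length ws = CARD('n)" "\<forall>w\<in>set ws. 0 \<le> w" "\<exists>w\<in>set ws. 0 < w"
    using cert by (auto simp: certifies_def list_all_iff list_ex_iff)
  obtain c :: "'n \<Rightarrow> real" where c: "range c = real_of_int ` set ws" 
    "int (slice_count UNIV c (of_int t)) = slice_num ws t"
    using slice_num_realised[of "UNIV :: 'n set" ws] ws(1) by auto
  have eq: "slice_count UNIV c (of_int t) = v" using c(2) W(3) by simp
  have "0 \<le> c i" for i
  proof -
    have "c i \<in> real_of_int ` set ws" using c(1) by blast
    then show ?thesis using ws(2) by auto
  qed
  moreover obtain j where "c j \<noteq> 0"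
  proof -
    obtain w where "w \<in> set ws" "0 < w" using ws(3) by blast
    then have "real_of_int w \<in> range c" using c(1) by blast
    then obtain j where "c j = real_of_int w" by (metis imageE)
    then show ?thesis using that[of j] \<open>0 < w\<close> by simp
  qed
  ultimately show ?thesis using slice_count_in_VSS[of c j "of_int t"] eq v(2) by simp
qed

text \<open>
  The following weight vectors and levels realize every value that is not excluded. One weight
  vector gives many values at different levels, which keeps the lists short.
\<close>

lemma certificate_2:
  "certifies 2
    [([1, 1], [0, 1])]
    ([1..2])"
  by code_simp

lemma certificate_3:
  "certifies 3
    [([3, 3, 2], [0, 1, 3, 4]),
      ([1, 1, 0], [0]),
      ([3, 2, 2], [3])]
    ([1..6])"
  by code_simp

lemma certificate_4:
  "certifies 4
    [([4, 3, 2, 1], [0, 1, 2, 3, 4, 5]),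
      ([3, 3, 2, 0], [0, 3, 4]),
      ([3, 3, 2, 2], [4])]
    (filter (\<lambda>v. v \<notin> set [3, 5]) [1..12])"
  by code_simp

lemma certificate_5:
  "certifies 5
    [([6, 6, 3, 3, 2], [0, 1, 3, 4, 5, 6, 7, 8, 9, 10]),
      ([6, 4, 3, 2, 2], [3, 4, 5, 6, 7, 8]),
      ([5, 5, 4, 1, 1], [2, 6, 8]),
      ([6, 4, 4, 2, 2], [7, 9]),
      ([6, 6, 6, 4, 4], [11, 13]),
      ([1, 1, 1, 0, 0], [0]),
      ([1, 1, 1, 1, 0], [0]),
      ([6, 6, 4, 4, 4], [11])]
    (filter (\<lambda>v. v \<notin> set [3, 6, 7, 9]) [1..30])"
  by code_simp

lemma certificate_6:
  "certifies 6
    [([8, 8, 7, 7, 4, 2], [0, 1, 3, 5, 6, 7, 8, 9, 10, 11, 12, 13, 14, 15, 16, 17, 18]),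
      ([8, 7, 6, 3, 3, 3], [4, 6, 7, 8, 9, 10, 11, 12, 13, 14, 15]),
      ([8, 8, 7, 5, 4, 1], [6, 7, 8, 9, 10, 11, 14, 16]),
      ([8, 5, 3, 3, 2, 2], [4, 5, 6, 8, 10]),
      ([8, 7, 6, 6, 6, 5], [8, 11, 15, 16]),
      ([8, 8, 5, 4, 3, 2], [5, 6, 8]),
      ([6, 6, 4, 4, 4, 0], [0, 11]),
      ([1, 1, 1, 0, 0, 0], [0]),
      ([1, 1, 1, 1, 0, 0], [0]),
      ([5, 5, 4, 4, 2, 2], [10])]
    (filter (\<lambda>v. v \<notin> set [3, 5, 7, 9, 11, 12, 59]) [1..60])"
  by code_simp

lemma certificate_7:
  "certifies 7
    [([11, 11, 10, 10, 5, 3, 2], [0, 1, 3, 4, 5, 6, 7, 8, 9, 10, 11, 12, 13, 14, 15, 16, 17, 18, 19, 20, 21, 22, 23, 24, 25, 26]),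
      ([11, 11, 10, 10, 8, 6, 3], [9, 11, 12, 13, 14, 15, 16, 17, 18, 19, 20, 21, 22, 23, 24, 25, 26, 27, 28, 29]),
      ([11, 10, 9, 9, 7, 5, 4], [8, 10, 11, 12, 13, 15, 16, 17, 18, 19, 20, 21, 22, 24, 26, 27]),
      ([10, 8, 5, 4, 2, 2, 0], [0, 3, 4, 5, 6, 7, 8, 9, 10, 11, 12, 13, 14, 15]),
      ([11, 11, 10, 8, 7, 4, 3], [9, 11, 12, 13, 14, 16, 17, 18, 20, 22, 25, 26, 27]),
      ([10, 9, 8, 7, 7, 7, 6], [9, 10, 15, 16, 17, 20, 25, 26, 27]),
      ([9, 8, 8, 4, 3, 1, 1], [3, 4, 6, 7, 10, 14, 16]),
      ([11, 6, 4, 3, 2, 2, 2], [5, 6, 7, 8, 9]),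
      ([10, 10, 10, 8, 8, 8, 7], [17, 27, 29, 30]),
      ([9, 9, 8, 8, 4, 4, 4], [8, 22, 23]),
      ([10, 9, 8, 8, 8, 7, 6], [26, 27, 28]),
      ([6, 6, 6, 4, 4, 4, 4], [15, 17]),
      ([8, 8, 7, 7, 6, 5, 5], [22, 23]),
      ([1, 1, 1, 1, 0, 0, 0], [0]),
      ([1, 1, 1, 1, 1, 0, 0], [0]),
      ([3, 3, 2, 2, 1, 1, 1], [3]),
      ([6, 6, 4, 4, 4, 4, 4], [15]),
      ([6, 6, 6, 6, 4, 4, 4], [17]),
      ([10, 10, 9, 8, 7, 7, 6], [28])]
    (filter (\<lambda>v. v \<notin> set [3, 5, 6, 9, 10, 11, 13, 14, 15, 18]) [1..140])"
  by code_simp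

lemma VSS_hypercube_eqI:
  assumes "certifies CARD('n) W vs" "CARD('n) \<le> 7" "\<forall>v\<in>slice_values CARD('n). int v \<in> set vs"
  shows "VSS (hypercube :: (real ^ 'n) set) = slice_values CARD('n)"
proof (rule equalityI)
  show "slice_values CARD('n) \<subseteq> VSS (hypercube :: (real ^ 'n) set)"
  proof
    fix v assume v: "v \<in> slice_values CARD('n)"
    then have "v \<noteq> 0" by (simp add: slice_values_def)
    with v assms(3) show "v \<in> VSS (hypercube :: (real ^ 'n) set)"
      by (intro certifies_VSS[OF assms(1)]) auto
  qed
qed (rule VSS_hypercube_subset[OF assms(2)])

lemma slice_values_numerals:
  "slice_values 2 = {1..2}"
  "slice_values 3 = {1..6}"
  "slice_values 4 = {1..12} - {3, 5}"
  "slice_values 5 = {1..30} - {3, 6, 7, 9}"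
  "slice_values 6 = {1..60} - {3, 5, 7, 9, 11, 12, 59}"
  "slice_values 7 = {1..140} - {3, 5, 6, 9, 10, 11, 13, 14, 15, 18}"
  by (auto simp: slice_values_def low_gaps_def max_slice_numerals)

theorem corollary1p5p1:
  shows
    "VSS (hypercube :: (real ^ 2) set) = {1..2} \<and>
     VSS (hypercube :: (real ^ 3) set) = {1..6} \<and>
     VSS (hypercube :: (real ^ 4) set) = {1..12} - {3, 5} \<and>
     VSS (hypercube :: (real ^ 5) set) = {1..30} - {3, 6, 7, 9} \<and>
     VSS (hypercube :: (real ^ 6) set) = {1..60} - {3, 5, 7, 9, 11, 12, 59} \<and>
     VSS (hypercube :: (real ^ 7) set) = {1..140} - {3, 5, 6, 9, 10, 11, 13, 14, 15, 18}"
proof (intro conjI)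
  show "VSS (hypercube :: (real ^ 2) set) = {1..2}"
    using VSS_hypercube_eqI[where 'n = 2] certificate_2 by (simp add: slice_values_numerals)
  show "VSS (hypercube :: (real ^ 3) set) = {1..6}"
    using VSS_hypercube_eqI[where 'n = 3] certificate_3 by (simp add: slice_values_numerals)
  show "VSS (hypercube :: (real ^ 4) set) = {1..12} - {3, 5}"
    using VSS_hypercube_eqI[where 'n = 4] certificate_4 by (simp add: slice_values_numerals)
  show "VSS (hypercube :: (real ^ 5) set) = {1..30} - {3, 6, 7, 9}"
    using VSS_hypercube_eqI[where 'n = 5] certificate_5 by (simp add: slice_values_numerals)
  show "VSS (hypercube :: (real ^ 6) set) = {1..60} - {3, 5, 7, 9, 11, 12, 59}"
    using VSS_hypercube_eqI[where 'n = 6] certificate_6 by (simp add: slice_values_numerals)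
  show "VSS (hypercube :: (real ^ 7) set) = {1..140} - {3, 5, 6, 9, 10, 11, 13, 14, 15, 18}"
    using VSS_hypercube_eqI[where 'n = 7] certificate_7 by (simp add: slice_values_numerals)
qed

end
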